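(* Let $n\geq 2$ and let $\Omega\subset\mathbb{S}^{n}$ be a domain whose closure $\bar\Omega$ is geodesically convex. Let $\Gamma\subset\mathbb{R}^{n}$ be a symmetric, open and convex cone containing $\Gamma_{+}=\{\kappa\in\mathbb{R}^n : \kappa_i>0\ \forall\, 1\le i\le n\}$, and let $u\in C^{2}(\Omega)\cap C^{1}(\bar\Omega)$ be a solution to $$f(|\nabla u|,-\nabla^{2}u)=b(\cdot,u,|\nabla u|)\quad\text{in }\Omega .$$ Suppose the function $f:[0,\infty)\times\mathcal{D}_{\bar\Gamma}\to\mathbb{R}$ has the following properties: (i) for every $p\in[0,\infty)$, $f(p,\cdot)$ is an isotropic function on $\mathcal{D}_{\bar\Gamma}$; (ii) $f$ is increasing in the first variable: $p\leq q\ \Rightarrow\ f(p,\cdot)\leq f(q,\cdot)$; (iii) $f$ is increasing in the second variable: for $\kappa,\lambda\in\bar\Gamma$, if $\kappa_i\le\lambda_i$ for all $1\le i\le n$, then $f(\cdot,\mathrm{diag}(\kappa_1,\dots,\kappa_n))\leq f(\cdot,\mathrm{diag}(\lambda_1,\dots,\lambda_n))$; (iv) $f$ is convex in the second variable: $f(\cdot,\tfrac12(A+B))\leq\tfrac12\left(f(\cdot,A)+f(\cdot,B)\right)$ for all $A,B\in\mathcal{D}_{\bar\Gamma}$. Suppose the function $b:\Omega\times\mathbb{R}\times[0,\infty)\to\mathbb{R}$ is (a) decreasing (in the non-strict sense) in the third variable; (b) jointly concave in the first two variables, in the sense that for all $x,y\in\Omega$ and $p\in[0,\infty)$ $$b\left(\gamma_{x,y}(0),\tfrac12(u(x)+u(y)),p\right)\geq\tfrac12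 b(x,u(x),p)+\tfrac12 b(y,u(y),p);$$ (c) strictly decreasing in the second variable. If furthermore for all $(x,y)\in\partial\Omega\times\bar\Omega$ with $x\neq y$ there holds $$Du_{x}(\dot\gamma_{x,y}(-1))-Du_{y}(\dot\gamma_{x,y}(1))>0,$$ then $u$ is concave.
   Context: $\mathbb{S}^n$ is the unit sphere with round metric $\sigma$ and Levi-Civita connection $D$. A subset $C\subset\mathbb{S}^n$ is geodesically convex if no two points of $C$ are antipodal and the unique minimizing geodesic segment between any two points of $C$ lies entirely in $C$. A domain is a connected open set. It is understood that the minimizing geodesic joining two points of $\Omega$ stays in $\Omega$. For $x,y\in\bar\Omega$, $\gamma_{x,y}:[-1,1]\to\bar\Omega$ denotes the unique minimizing geodesic (parametrized proportionally to arc length) with $\gamma_{x,y}(-1)=x$ and $\gamma_{x,y}(1)=y$; thus $\gamma_{x,y}(0)$ is the midpoint. $\nabla u=(Du)^\sharp$ is the gradient vector field and $\nabla^2u=(D^2u)^\sharp$ is the Hessian endomorphism field (index raised with $\sigma$); $Du_x$ is the differential of $u$ at $x$ (for $x\in\partial\Omega$, understood through $u\in C^1(\bar\Omega)$). $\Gamma$ symmetric means invariant under permutations of coordinates. $\mathcal{D}_{\bar\Gamma}$ is the set of real symmetric $n\times n$ matrices whose $n$-tuple of eigenvalues lies in the closure $\bar\Gamma$. A function is isotropic if it is invariant under conjugation by invertible linear maps, $f(\mathcal{W})=f(V^{-1}\circ\mathcal{W}\circ V)$; in particular on $\mathcal{D}_{\bar\Gamma}$ it depends only on the eigenvalues of its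 argument. By this invariance $f(p,\cdot)$ is also defined on self-adjoint endomorphisms, with eigenvalues in $\bar\Gamma$, of any $n$-dimensional inner product space (via the matrix in any orthonormal basis), and in particular on endomorphisms of $T_x\mathbb{S}^n$. That $u$ solves the equation includes that the eigenvalues of $-\nabla^2u(x)$ lie in $\bar\Gamma$ for every $x\in\Omega$, so that the left-hand side is defined. $u$ is concave if for every geodesic $\gamma:[-1,1]\to\bar\Omega$ the function $t\mapsto u(\gamma(t))$ is concave. *)

theory Defs
  imports "HOL-Analysis.Analysis"
begin

text \<open>
  The round sphere of dimension \<open>n = CARD('n)\<close> is \<open>sphere 0 1\<close> in a Euclidean space
  \<open>'a\<close> with \<open>DIM('a) = n + 1\<close>; the round metric is the restriction of the inner product,
  and its Levi-Civita connection is the tangential part of the ambient derivative.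
\<close>

definition tangent_space :: "'a::euclidean_space \<Rightarrow> 'a set" where
  "tangent_space x = {v. v \<bullet> x = 0}"

definition tangent_proj :: "'a::euclidean_space \<Rightarrow> 'a \<Rightarrow> 'a" where
  "tangent_proj x v = v - (v \<bullet> x) *\<^sub>R x"

text \<open>A \<open>C\<^sup>2\<close> curve on the sphere whose velocity is parallel along the curve; constant curves
  are included.\<close>

definition geodesic_on :: "real set \<Rightarrow> (real \<Rightarrow> 'a::euclidean_space) \<Rightarrow> bool" where
  "geodesic_on I \<gamma> \<longleftrightarrow>
     \<gamma> ` I \<subseteq> sphere 0 1 \<and>
     (\<exists>\<gamma>' \<gamma>''. continuous_on I \<gamma>'' \<and>
        (\<forall>t\<in>I. (\<gamma> has_vector_derivative \<gamma>' t) (at t within I) \<and>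
               (\<gamma>' has_vector_derivative \<gamma>'' t) (at t within I) \<and>
               tangent_proj (\<gamma> t) (\<gamma>'' t) = 0))"

definition velocity :: "(real \<Rightarrow> 'a::euclidean_space) \<Rightarrow> real \<Rightarrow> 'a" where
  "velocity c t = vector_derivative c (at t within {-1..1})"

definition C1_curve :: "(real \<Rightarrow> 'a::euclidean_space) \<Rightarrow> bool" where
  "C1_curve c \<longleftrightarrow>
     (\<forall>t\<in>{-1..1}. c differentiable (at t within {-1..1})) \<and> continuous_on {-1..1} (velocity c)"

definition curve_length :: "(real \<Rightarrow> 'a::euclidean_space) \<Rightarrow> real" where
  "curve_length c = integral {-1..1} (\<lambda>t. norm (velocity c t))"

definition minimizing_geodesic :: "(real \<Rightarrow> 'a::euclidean_space) \<Rightarrow> bool" where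
  "minimizing_geodesic \<gamma> \<longleftrightarrow>
     geodesic_on {-1..1} \<gamma> \<and>
     (\<forall>c. C1_curve c \<and> c ` {-1..1} \<subseteq> sphere 0 1 \<and> c (-1) = \<gamma> (-1) \<and> c 1 = \<gamma> 1
          \<longrightarrow> curve_length \<gamma> \<le> curve_length c)"

text \<open>For non-antipodal points \<open>x\<close>, \<open>y\<close> of the sphere the curve below is uniquely
  determined on \<open>{-1..1}\<close>, the only part that is ever used; outside it is arbitrary.\<close>

definition geo :: "'a::euclidean_space \<Rightarrow> 'a \<Rightarrow> real \<Rightarrow> 'a" where
  "geo x y = (SOME \<gamma>. minimizing_geodesic \<gamma> \<and> \<gamma> (-1) = x \<and> \<gamma> 1 = y)"

definition geodesically_convex :: "'a::euclidean_space set \<Rightarrow> bool" where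
  "geodesically_convex C \<longleftrightarrow>
     C \<subseteq> sphere 0 1 \<and> (\<forall>x\<in>C. \<forall>y\<in>C. y \<noteq> - x \<and> geo x y ` {-1..1} \<subseteq> C)"

text \<open>Derivatives within the sphere are determined only on tangent vectors, and the functions
  below are meant to be applied to tangent vectors only. Being local, they do not depend on values
  outside a relatively open set.\<close>

definition differential ::
    "('a::euclidean_space \<Rightarrow> 'b::real_normed_vector) \<Rightarrow> 'a \<Rightarrow> 'a \<Rightarrow> 'b" where
  "differential u x = frechet_derivative u (at x within sphere 0 1)"

definition grad :: "('a::euclidean_space \<Rightarrow> real) \<Rightarrow> 'a \<Rightarrow> 'a" where
  "grad u x = (THE g. g \<in> tangent_space x \<and> (\<forall>v\<in>tangent_space x. g \<bullet> v = differential u x v))"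

definition cov_deriv :: "('a::euclidean_space \<Rightarrow> 'a) \<Rightarrow> 'a \<Rightarrow> 'a \<Rightarrow> 'a" where
  "cov_deriv X x v = tangent_proj x (differential X x v)"

text \<open>The connection is metric, so raising an index of the second covariant derivative of \<open>u\<close>
  gives the covariant derivative of the gradient field.\<close>

definition hess :: "('a::euclidean_space \<Rightarrow> real) \<Rightarrow> 'a \<Rightarrow> 'a \<Rightarrow> 'a" where
  "hess u x v = cov_deriv (grad u) x v"

definition C2_on :: "'a::euclidean_space set \<Rightarrow> ('a \<Rightarrow> real) \<Rightarrow> bool" where
  "C2_on \<Omega> u \<longleftrightarrow>
     (\<forall>x\<in>\<Omega>. u differentiable (at x within sphere 0 1) \<and>
            grad u differentiable (at x within sphere 0 1)) \<and>
     (\<forall>v. continuous_on \<Omega> (\<lambda>x. hess u x (tangent_proj x v)))"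

definition C1_on_closure :: "'a::euclidean_space set \<Rightarrow> ('a \<Rightarrow> real) \<Rightarrow> bool" where
  "C1_on_closure \<Omega> u \<longleftrightarrow>
     continuous_on (closure \<Omega>) u \<and>
     (\<forall>x\<in>\<Omega>. u differentiable (at x within sphere 0 1)) \<and>
     (\<exists>G. continuous_on (closure \<Omega>) G \<and> (\<forall>x\<in>\<Omega>. G x = grad u x))"

text \<open>The differential at points of the closure, through the continuous extension of the
  gradient; at points of \<open>\<Omega>\<close> it is the ordinary differential.\<close>

definition differential_ext ::
    "'a::euclidean_space set \<Rightarrow> ('a \<Rightarrow> real) \<Rightarrow> 'a \<Rightarrow> 'a \<Rightarrow> real" where
  "differential_ext \<Omega> u x v = Lim (at x within \<Omega>) (grad u) \<bullet> v"

definition concave_along_geodesics :: "'a::euclidean_space set \<Rightarrow> ('a \<Rightarrow> real) \<Rightarrow> bool" where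
  "concave_along_geodesics C u \<longleftrightarrow>
     (\<forall>\<gamma>. geodesic_on {-1..1} \<gamma> \<and> \<gamma> ` {-1..1} \<subseteq> C \<longrightarrow> concave_on {-1..1} (\<lambda>t. u (\<gamma> t)))"

text \<open>Only positive multiples are required: the library predicate \<^const>\<open>cone\<close> would force
  \<open>0 \<in> \<Gamma>\<close>, hence \<open>\<Gamma> = UNIV\<close> for open \<open>\<Gamma>\<close>.\<close>

definition positive_cone :: "'a::real_vector set \<Rightarrow> bool" where
  "positive_cone \<Gamma> \<longleftrightarrow> (\<forall>\<kappa>\<in>\<Gamma>. \<forall>c>0. c *\<^sub>R \<kappa> \<in> \<Gamma>)"

definition symmetric_set :: "(real ^ 'n) set \<Rightarrow> bool" where
  "symmetric_set \<Gamma> \<longleftrightarrow> (\<forall>\<pi>. \<pi> permutes UNIV \<longrightarrow> (\<forall>\<kappa>\<in>\<Gamma>. (\<chi> i. \<kappa> $ \<pi> i) \<in> \<Gamma>))"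

text \<open>The entries of \<open>\<kappa>\<close> are the eigenvalues of \<open>A\<close>, with multiplicity.\<close>

definition eigenvalue_tuple :: "real ^ 'n ^ 'n \<Rightarrow> real ^ 'n \<Rightarrow> bool" where
  "eigenvalue_tuple A \<kappa> \<longleftrightarrow> (\<forall>s. det (mat s - A) = (\<Prod>i\<in>UNIV. s - \<kappa> $ i))"

definition sym_matrices :: "(real ^ 'n) set \<Rightarrow> (real ^ 'n ^ 'n) set" where
  "sym_matrices K = {A. transpose A = A \<and> (\<exists>\<kappa>\<in>K. eigenvalue_tuple A \<kappa>)}"

definition diag_matrix :: "real ^ 'n \<Rightarrow> real ^ 'n ^ 'n" where
  "diag_matrix \<kappa> = (\<chi> i j. if i = j then \<kappa> $ i else 0)"

definition isotropic_on :: "(real ^ 'n ^ 'n) set \<Rightarrow> (real ^ 'n ^ 'n \<Rightarrow> real) \<Rightarrow> bool" where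
  "isotropic_on \<D> F \<longleftrightarrow>
     (\<forall>W\<in>\<D>. \<forall>V. invertible V \<and> matrix_inv V ** W ** V \<in> \<D> \<longrightarrow> F W = F (matrix_inv V ** W ** V))"

definition orthonormal_frame :: "'a::euclidean_space \<Rightarrow> ('n::finite \<Rightarrow> 'a) \<Rightarrow> bool" where
  "orthonormal_frame x e \<longleftrightarrow>
     (\<forall>i j. e i \<bullet> e j = (if i = j then 1 else 0)) \<and> span (range e) = tangent_space x"

text \<open>The matrix of an endomorphism of the tangent space at \<open>x\<close> in an orthonormal basis. Membership
  in \<^const>\<open>sym_matrices\<close> and values of isotropic functions do not depend on the basis chosen.\<close>

definition tangent_matrix :: "'a::euclidean_space \<Rightarrow> ('a \<Rightarrow> 'a) \<Rightarrow> real ^ 'n ^ 'n" where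
  "tangent_matrix x L =
     (let e = (SOME e :: 'n \<Rightarrow> 'a. orthonormal_frame x e) in \<chi> i j. e i \<bullet> L (e j))"

definition solves ::
    "(real ^ 'n) set \<Rightarrow> (real \<Rightarrow> real ^ 'n ^ 'n \<Rightarrow> real) \<Rightarrow>
     ('a::euclidean_space \<Rightarrow> real \<Rightarrow> real \<Rightarrow> real) \<Rightarrow> 'a set \<Rightarrow> ('a \<Rightarrow> real) \<Rightarrow> bool" where
  "solves \<Gamma> f b \<Omega> u \<longleftrightarrow>
     (\<forall>x\<in>\<Omega>. tangent_matrix x (\<lambda>v. - hess u x v) \<in> sym_matrices (closure \<Gamma>) \<and>
            f (norm (grad u x)) (tangent_matrix x (\<lambda>v. - hess u x v))
              = b x (u x) (norm (grad u x)))"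

end

theory Submission
  imports Defs
begin

text \<open>Write \<open>m = sgn (x + y)\<close> for the midpoint of the minimizing geodesic between \<open>x\<close> and \<open>y\<close>, and let
  \<open>concavity_gap u x y = u m - (u x + u y) / 2\<close>. The solution \<open>u\<close> is concave once this function of two
  points is nonnegative on \<open>closure \<Omega> \<times> closure \<Omega>\<close>. That set is compact, so it is enough to look at a
  pair \<open>x \<noteq> y\<close> at which the gap attains its minimum.

  If \<open>x\<close> is a boundary point, then moving both points towards each other at equal speed keeps the
  midpoint fixed, and by the boundary condition it strictly increases \<open>u x + u y\<close>; so the gap
  decreases, and the pair was not a minimum (\<open>boundary_descent\<close>).

  If both points lie in \<open>\<Omega>\<close>, then the first and second variations of the gap are evaluated along two
  families of motions (\<open>two_point_comparison\<close>). Let \<open>e\<close> be the direction of the geodesic, let \<open>c\<close> be the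
  cosine of half the distance of \<open>x\<close> and \<open>y\<close>, and identify the tangent spaces at \<open>x\<close>, \<open>y\<close> and \<open>m\<close> by
  parallel transport along the geodesic; write \<open>W\<^sub>x\<close>, \<open>W\<^sub>y\<close>, \<open>W\<^sub>m\<close> for the negative Hessians,
  \<open>M = (W\<^sub>x + W\<^sub>y) / 2\<close>, and \<open>K\<close> for the map that fixes \<open>e\<close> and multiplies its orthogonal complement by
  \<open>c\<close>.
  \<^item> Moving \<open>x\<close> and \<open>y\<close> in opposite directions keeps \<open>m\<close> fixed. Hence \<open>M\<close> is positive semidefinite and
    the two gradients agree.
  \<^item> Moving \<open>x\<close> and \<open>y\<close> in the same direction \<open>K w\<close> moves \<open>m\<close> in the direction \<open>w\<close>. Hence
    \<open>W\<^sub>m \<le> K M K\<close> as quadratic forms, and the gradient at \<open>m\<close> is at most as long as those at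
    \<open>x\<close> and \<open>y\<close>.

  In general \<open>K M K \<le> M\<close> fails as an inequality of quadratic forms. It is isotropy and convexity of \<open>f\<close>
  that still give \<open>f p W\<^sub>m \<le> f p M\<close>, where \<open>p\<close> is the length of the gradient at \<open>x\<close>
  (\<open>contraction_le\<close>): a convex isotropic function does not increase when the entries of a matrix
  that couple \<open>e\<close> with its complement are damped, because the damped matrix is a convex combination
  of the matrix and of its image under the reflection along \<open>e\<close>. The same device, applied to all
  coordinates, turns monotonicity in the eigenvalues into monotonicity in the Loewner order
  (\<open>mono_psd\<close>). Since \<open>M\<close> is positive semidefinite, its damped versions and their diagonal parts have
  nonnegative eigenvalues and so stay in the domain of \<open>f\<close>.

  Now suppose that the gap is negative at the pair. By monotonicity and convexity of \<open>f\<close>, the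
  equation at the three points, and the hypotheses on \<open>b\<close>,
  \<open>b(m, u m, |\<nabla>u m|) \<le> f p M \<le> (b(x, u x, p) + b(y, u y, p)) / 2 \<le> b(m, (u x + u y) / 2, |\<nabla>u m|)\<close>,
  which contradicts \<open>u m < (u x + u y) / 2\<close> because \<open>b\<close> is strictly decreasing in its second argument
  (\<open>interior_minimum_nonneg\<close>).

  Throughout, geodesics are handled in ambient coordinates: a minimizing geodesic is an arc
  \<open>cos (\<beta> * t) *\<^sub>R m + sin (\<beta> * t) *\<^sub>R e\<close> (\<open>geo_eq_great_circle\<close>), and motions of points are straight lines
  in the ambient space, pushed back to the sphere by \<^const>\<open>sgn\<close>.\<close>

section \<open>Great circles and minimizing geodesics\<close>

text \<open>For orthonormal \<open>p\<close> and \<open>q\<close>, the great circle through \<open>p\<close> with velocity \<open>k *\<^sub>R q\<close> there. The velocity is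
  again \<open>k\<close> times a function of this form, with \<open>(p, q)\<close> replaced by \<open>(q, - p)\<close>.\<close>

definition great_circle :: "'a::euclidean_space \<Rightarrow> 'a \<Rightarrow> real \<Rightarrow> real \<Rightarrow> 'a" where
  "great_circle p q k t = cos (k * t) *\<^sub>R p + sin (k * t) *\<^sub>R q"

lemma great_circle_has_vector_derivative:
  "(great_circle p q k has_vector_derivative k *\<^sub>R great_circle q (- p) k t) (at t within S)"
  unfolding great_circle_def
  by (auto intro!: derivative_eq_intros simp: algebra_simps)

lemma great_circle_inner:
  assumes "p \<bullet> q = 0"
  shows "great_circle p q k s \<bullet> great_circle p q k t
    = cos (k * s) * cos (k * t) * (p \<bullet> p) + sin (k * s) * sin (k * t) * (q \<bullet> q)"
  using assms by (simp add: great_circle_def inner_add_left inner_add_right inner_commute)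

lemma norm_great_circle:
  assumes "norm p = 1" "norm q = 1" "p \<bullet> q = 0"
  shows "norm (great_circle p q k t) = 1"
  using assms great_circle_inner[OF assms(3), of k t t]
  by (simp add: norm_eq_1 power2_eq_square[symmetric])

lemma geodesic_on_great_circle:
  assumes "norm p = 1" "norm q = 1" "p \<bullet> q = 0"
  shows "geodesic_on I (great_circle p q k)"
proof -
  let ?g = "\<lambda>t. k *\<^sub>R great_circle q (- p) k t"
  let ?h = "\<lambda>t. k *\<^sub>R (k *\<^sub>R great_circle (- p) (- q) k t)"
  have "(?g has_vector_derivative ?h t) (at t within I)" for t
    using has_vector_derivative_scaleR[OF DERIV_const great_circle_has_vector_derivative, of k q "-p" k t I]
    by simp
  moreover have "continuous_on I ?h"
    unfolding great_circle_def by (intro continuous_intros)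
  moreover have "?h t = - (k\<^sup>2) *\<^sub>R great_circle p q k t" for t
    by (simp add: great_circle_def power2_eq_square algebra_simps)
  then have "tangent_proj (great_circle p q k t) (?h t) = 0" for t
    using norm_great_circle[OF assms, of k t]
    by (simp add: tangent_proj_def norm_eq_1)
  ultimately show ?thesis
    using norm_great_circle[OF assms] great_circle_has_vector_derivative
    unfolding geodesic_on_def by (intro conjI exI[of _ ?g] exI[of _ ?h]) auto
qed

lemma has_vector_derivative_unique_within_I:
  assumes "(f has_vector_derivative a) (at t within {-1..1::real})"
    and "(g has_vector_derivative b) (at t within {-1..1})"
    and "t \<in> {-1..1}" and "\<And>s. s \<in> {-1..1} \<Longrightarrow> f s = g s"
  shows "a = b"
proof -
  have "(f has_vector_derivative b) (at t within {-1..1})"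
    using assms(2-4) by (rule has_vector_derivative_transform[rotated 2]) auto
  then show ?thesis
    using assms(1,3) vector_derivative_unique_within_closed_interval[of "-1" 1 t f] by simp
qed

text \<open>Differentiating \<open>\<gamma> \<bullet> \<gamma> = 1\<close> twice turns the geodesic equation into \<open>\<gamma>'' = - k\<^sup>2 \<gamma>\<close> with constant speed
  \<open>k\<close>, and this linear equation is solved by conserved quantities. The constant curves are the case
  \<open>k = 0\<close>.\<close>

lemma geodesic_on_great_circle_form:
  fixes \<gamma> :: "real \<Rightarrow> 'a::euclidean_space"
  assumes "geodesic_on {-1..1} \<gamma>"
  obtains k p q where "norm p = 1" "p \<bullet> q = 0" "k = 0 \<and> q = 0 \<or> 0 < k \<and> norm q = 1"
    "\<And>t. t \<in> {-1..1} \<Longrightarrow> \<gamma> t = great_circle p q k t"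
proof -
  let ?I = "{-1..1::real}"
  have sph: "\<gamma> t \<bullet> \<gamma> t = 1" if "t \<in> ?I" for t
    using assms that by (auto simp: geodesic_on_def image_subset_iff norm_eq_1[symmetric])
  from assms obtain \<gamma>' \<gamma>'' where
    d1: "\<And>t. t \<in> ?I \<Longrightarrow> (\<gamma> has_vector_derivative \<gamma>' t) (at t within ?I)"
    and d2: "\<And>t. t \<in> ?I \<Longrightarrow> (\<gamma>' has_vector_derivative \<gamma>'' t) (at t within ?I)"
    and tp: "\<And>t. t \<in> ?I \<Longrightarrow> tangent_proj (\<gamma> t) (\<gamma>'' t) = 0"
    unfolding geodesic_on_def by blast
  note ip = bounded_bilinear.has_vector_derivative[OF bounded_bilinear_inner]
  have perp: "\<gamma> t \<bullet> \<gamma>' t = 0" if t: "t \<in> ?I" for t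
    using has_vector_derivative_unique_within_I[OF ip[OF d1[OF t] d1[OF t]] has_vector_derivative_const t sph]
    by (simp add: inner_commute)
  have acc: "\<gamma> t \<bullet> \<gamma>'' t = - (\<gamma>' t \<bullet> \<gamma>' t)" if t: "t \<in> ?I" for t
    using has_vector_derivative_unique_within_I[OF ip[OF d1[OF t] d2[OF t]] has_vector_derivative_const t perp]
    by simp
  have ode: "\<gamma>'' t = - (\<gamma>' t \<bullet> \<gamma>' t) *\<^sub>R \<gamma> t" if t: "t \<in> ?I" for t
    using tp[OF t] acc[OF t] by (simp add: tangent_proj_def inner_commute eq_neg_iff_add_eq_0)
  have zero_const: "f t = f 0" if t: "t \<in> ?I" and f: "\<And>t. t \<in> ?I \<Longrightarrow> (f has_vector_derivative 0) (at t within ?I)"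
    for f :: "real \<Rightarrow> 'c::real_normed_vector" and t
  proof -
    obtain c where "\<And>t. t \<in> ?I \<Longrightarrow> f t = c"
      using has_vector_derivative_zero_constant[of ?I f] f by auto
    then show ?thesis using t by simp
  qed
  define k where "k = norm (\<gamma>' 0)"
  have speed: "\<gamma>' t \<bullet> \<gamma>' t = k\<^sup>2" if t: "t \<in> ?I" for t
  proof -
    have "((\<lambda>t. \<gamma>' t \<bullet> \<gamma>' t) has_vector_derivative 0) (at t within ?I)" if t: "t \<in> ?I" for t
      using ip[OF d2[OF t] d2[OF t]] perp[OF t] by (simp add: ode[OF t] inner_commute)
    then have "\<gamma>' t \<bullet> \<gamma>' t = \<gamma>' 0 \<bullet> \<gamma>' 0" using t by (intro zero_const) auto
    then show ?thesis by (simp add: k_def power2_norm_eq_inner)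
  qed
  show ?thesis
  proof (cases "k = 0")
    case True
    have "(\<gamma> has_vector_derivative 0) (at t within ?I)" if t: "t \<in> ?I" for t
      using d1[OF t] speed[OF t] True by simp
    then have const: "\<gamma> t = great_circle (\<gamma> 0) 0 0 t" if "t \<in> ?I" for t
      using zero_const[of t \<gamma>] that by (simp add: great_circle_def)
    show ?thesis
      by (rule that[OF _ _ _ const]) (use sph[of 0] in \<open>auto simp: norm_eq_1\<close>)
  next
    case False
    then have k: "k > 0" by (simp add: k_def)
    \<comment> \<open>Rotating the pair \<open>(\<gamma>, \<gamma>' / k)\<close> back by the angle \<open>k * t\<close> gives a constant pair.\<close>
    define a where "a t = cos (k * t) *\<^sub>R \<gamma> t - (sin (k * t) / k) *\<^sub>R \<gamma>' t" for t
    define b where "b t = sin (k * t) *\<^sub>R \<gamma> t + (cos (k * t) / k) *\<^sub>R \<gamma>' t" for t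
    have "(a has_vector_derivative 0) (at t within ?I)" "(b has_vector_derivative 0) (at t within ?I)"
      if t: "t \<in> ?I" for t
      unfolding a_def b_def using k
      by (auto intro!: derivative_eq_intros d1[OF t] d2[OF t]
          simp: ode[OF t] speed[OF t] power2_eq_square)
    then have ab: "a t = a 0" "b t = b 0" if "t \<in> ?I" for t using that by (auto intro!: zero_const)
    have form: "\<gamma> t = great_circle (a 0) (b 0) k t" if t: "t \<in> ?I" for t
    proof -
      have "cos (k * t) *\<^sub>R a t + sin (k * t) *\<^sub>R b t = (cos (k * t) * cos (k * t) + sin (k * t) * sin (k * t)) *\<^sub>R \<gamma> t"
        unfolding a_def b_def scaleR_add_left by (simp add: scaleR_add_right scaleR_diff_right mult.commute)
      then show ?thesis using ab[OF t] by (simp add: great_circle_def)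
    qed
    have "a 0 = \<gamma> 0" "b 0 = (1 / k) *\<^sub>R \<gamma>' 0" by (simp_all add: a_def b_def)
    then have "norm (a 0) = 1" "a 0 \<bullet> b 0 = 0" "norm (b 0) = 1"
      using k sph[of 0] perp[of 0] by (auto simp: norm_eq_1[symmetric] k_def)
    then show ?thesis using that[OF _ _ _ form] k by blast
  qed
qed

lemma velocity_eqI:
  fixes c :: "real \<Rightarrow> 'a::euclidean_space"
  assumes "(g has_vector_derivative v) (at t within {-1..1})" "t \<in> {-1..1}"
    and "\<And>s. s \<in> {-1..1} \<Longrightarrow> c s = g s"
  shows "velocity c t = v"
proof -
  have "(c has_vector_derivative v) (at t within {-1..1})"
    using assms by (intro has_vector_derivative_transform[OF _ _ assms(1)]) auto
  then show ?thesis
    using assms(2) vector_derivative_within_closed_interval[of "-1" 1 t c v] by (simp add: velocity_def)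
qed

lemma curve_length_great_circle:
  assumes pq: "norm p = 1" "norm q = 1" "p \<bullet> q = 0" and "0 \<le> k"
    and c: "\<And>s. s \<in> {-1..1} \<Longrightarrow> c s = great_circle p q k s"
  shows "curve_length c = 2 * k"
proof -
  have n: "norm (velocity c t) = k" if "t \<in> {-1..1}" for t
    using velocity_eqI[OF great_circle_has_vector_derivative that c]
      norm_great_circle[of q "-p" k t] assms by (simp add: inner_commute)
  have "integral {-1..1} (\<lambda>t. norm (velocity c t)) = integral {-1..1::real} (\<lambda>t. k)"
    by (rule Henstock_Kurzweil_Integration.integral_cong) (rule n)
  then show ?thesis by (simp add: curve_length_def)
qed

text \<open>The distance \<open>arccos (c t \<bullet> c (-1))\<close> from the starting point grows at most at the speed of the curve.
  It is not differentiable where \<open>c t\<close> is the starting point or its antipode; the factor \<open>r < 1\<close>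
  removes these singularities without spoiling the bound, and is sent to 1 at the end.\<close>

lemma arccos_le_curve_length:
  fixes c :: "real \<Rightarrow> 'a::euclidean_space"
  assumes C1: "C1_curve c" and sph: "c ` {-1..1} \<subseteq> sphere 0 1"
  shows "arccos (c (-1) \<bullet> c 1) \<le> curve_length c"
proof -
  let ?I = "{-1..1::real}"
  define x where "x = c (-1)"
  have unit: "c t \<bullet> c t = 1" if "t \<in> ?I" for t using sph that by (auto simp: norm_eq_1[symmetric] image_subset_iff)
  then have x: "x \<bullet> x = 1" by (simp add: x_def)
  have dc: "(c has_vector_derivative velocity c t) (at t within ?I)" if "t \<in> ?I" for t
    using C1 that by (auto simp: C1_curve_def velocity_def vector_derivative_works[symmetric])
  have perp: "c t \<bullet> velocity c t = 0" if t: "t \<in> ?I" for t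
    using has_vector_derivative_unique_within_I[OF
        bounded_bilinear.has_vector_derivative[OF bounded_bilinear_inner dc[OF t] dc[OF t]]
        has_vector_derivative_const t unit]
    by (simp add: inner_commute)
  have int: "(\<lambda>t. norm (velocity c t)) integrable_on ?I"
    using C1 by (auto simp: C1_curve_def intro!: integrable_continuous_interval continuous_intros)
  have bound: "arccos (r * (c 1 \<bullet> x)) - arccos r \<le> curve_length c" if r: "0 < r" "r < 1" for r
  proof -
    define D where "D t = inverse (- sqrt (1 - (r * (c t \<bullet> x))\<^sup>2)) * (r * (velocity c t \<bullet> x))" for t
    have w: "(c t \<bullet> x)\<^sup>2 \<le> 1" if "t \<in> ?I" for t
      using Cauchy_Schwarz_ineq[of "c t" x] unit[OF that] x by simp
    have rw: "(r * (c t \<bullet> x))\<^sup>2 < 1" if "t \<in> ?I" for t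
    proof -
      have "(r * (c t \<bullet> x))\<^sup>2 \<le> r\<^sup>2 * 1"
        unfolding power_mult_distrib using w[OF that] by (intro mult_left_mono) auto
      also have "\<dots> < 1" using r by (simp add: power_less_one_iff)
      finally show ?thesis .
    qed
    have "((\<lambda>t. arccos (r * (c t \<bullet> x))) has_vector_derivative D t) (at t within ?I)"
      if t: "t \<in> ?I" for t
    proof -
      have "\<bar>r * (c t \<bullet> x)\<bar> < 1" using rw[OF t] by (simp add: abs_square_less_1)
      then have "DERIV arccos (r * (c t \<bullet> x)) :> inverse (- sqrt (1 - (r * (c t \<bullet> x))\<^sup>2))"
        by (intro DERIV_arccos) auto
      moreover have "((\<lambda>t. r * (c t \<bullet> x)) has_real_derivative r * (velocity c t \<bullet> x)) (at t within ?I)"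
        using dc[OF t] unfolding has_real_derivative_iff_has_vector_derivative has_vector_derivative_def
        by (auto intro!: derivative_eq_intros simp: algebra_simps)
      ultimately show ?thesis
        unfolding D_def has_real_derivative_iff_has_vector_derivative[symmetric]
        by (rule DERIV_chain2)
    qed
    then have "(D has_integral (arccos (r * (c 1 \<bullet> x)) - arccos (r * (c (-1) \<bullet> x)))) ?I"
      by (intro fundamental_theorem_of_calculus) auto
    moreover have "((\<lambda>t. norm (velocity c t)) has_integral curve_length c) ?I"
      using int by (simp add: curve_length_def has_integral_integral)
    moreover have "D t \<le> norm (velocity c t)" if t: "t \<in> ?I" for t
    proof -
      define s where "s = sqrt (1 - (r * (c t \<bullet> x))\<^sup>2)"
      have s: "s > 0" using rw[OF t] by (simp add: s_def)
      have "velocity c t \<bullet> x = velocity c t \<bullet> (x - (c t \<bullet> x) *\<^sub>R c t)"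
        using perp[OF t] by (simp add: inner_diff_right inner_commute)
      then have "\<bar>velocity c t \<bullet> x\<bar> \<le> norm (velocity c t) * norm (x - (c t \<bullet> x) *\<^sub>R c t)"
        by (simp add: Cauchy_Schwarz_ineq2)
      also have "norm (x - (c t \<bullet> x) *\<^sub>R c t) = sqrt (1 - (c t \<bullet> x)\<^sup>2)"
        using unit[OF t] x
        by (simp add: norm_eq_sqrt_inner inner_diff_left inner_diff_right power2_eq_square inner_commute)
      finally have 1: "r * \<bar>velocity c t \<bullet> x\<bar> \<le> norm (velocity c t) * (r * sqrt (1 - (c t \<bullet> x)\<^sup>2))"
        using r by (simp add: mult.left_commute)
      have "r * sqrt (1 - (c t \<bullet> x)\<^sup>2) = sqrt (r\<^sup>2 * (1 - (c t \<bullet> x)\<^sup>2))"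
        using r by (simp add: real_sqrt_mult)
      also have "\<dots> \<le> s"
        unfolding s_def using r by (simp add: algebra_simps power_mult_distrib power_le_one)
      finally have "norm (velocity c t) * (r * sqrt (1 - (c t \<bullet> x)\<^sup>2)) \<le> norm (velocity c t) * s"
        by (intro mult_left_mono) auto
      with 1 have 2: "r * \<bar>velocity c t \<bullet> x\<bar> \<le> norm (velocity c t) * s" by linarith
      have "D t \<le> \<bar>D t\<bar>" by simp
      also have "\<bar>D t\<bar> = r * \<bar>velocity c t \<bullet> x\<bar> / s"
        using s r unfolding D_def s_def[symmetric] by (simp add: abs_mult field_simps)
      also have "\<dots> \<le> norm (velocity c t)" using 2 s by (simp add: field_simps)
      finally show ?thesis .
    qed
    ultimately have "arccos (r * (c 1 \<bullet> x)) - arccos (r * (c (-1) \<bullet> x)) \<le> curve_length c"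
      by (rule has_integral_le) auto
    then show ?thesis using x by (simp add: x_def)
  qed
  have cont: "((\<lambda>r. arccos (r * a)) \<longlongrightarrow> arccos (1 * a)) (at_left 1)" if a: "\<bar>a\<bar> \<le> 1" for a :: real
  proof -
    have "\<bar>r * a\<bar> \<le> 1" if "r \<in> {0..1}" for r
      using a that by (simp add: abs_mult mult_le_one)
    then have "continuous_on {0..1} (\<lambda>r. arccos (r * a))"
      by (intro continuous_on_arccos continuous_intros) (auto simp: abs_le_iff)
    then show ?thesis
      by (metis continuous_on_Icc_at_leftD zero_less_one)
  qed
  have "\<bar>c 1 \<bullet> x\<bar> \<le> 1" using Cauchy_Schwarz_ineq2[of "c 1" x] unit[of 1] x by (simp add: norm_eq_sqrt_inner)
  then have "((\<lambda>r. arccos (r * (c 1 \<bullet> x)) - arccos (r * 1)) \<longlongrightarrow> arccos (1 * (c 1 \<bullet> x)) - arccos (1 * 1)) (at_left 1)"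
    by (intro tendsto_diff cont) auto
  moreover have "eventually (\<lambda>r. arccos (r * (c 1 \<bullet> x)) - arccos (r * 1) \<le> curve_length c) (at_left 1)"
    using bound unfolding eventually_at_left_field by (intro exI[of _ 0]) auto
  ultimately have "arccos (1 * (c 1 \<bullet> x)) - arccos (1 * 1) \<le> curve_length c"
    by (intro tendsto_upperbound[where F="at_left (1::real)"]) auto
  then show ?thesis by (simp add: x_def inner_commute)
qed

lemma half_angle:
  fixes x y :: "'a::euclidean_space"
  assumes "norm x = 1" "norm y = 1" "x \<noteq> y" "y \<noteq> - x"
  obtains \<beta> where "0 < \<beta>" "\<beta> < pi / 2" "cos \<beta> = norm (x + y) / 2" "sin \<beta> = norm (y - x) / 2"
proof -
  have sq: "(norm (x + y) / 2)\<^sup>2 + (norm (y - x) / 2)\<^sup>2 = 1"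
    using assms by (simp add: power_divide power2_norm_eq_inner inner_add_left inner_add_right
        inner_diff_left inner_diff_right inner_commute norm_eq_1 field_simps)
  have pos: "norm (x + y) / 2 > 0" "norm (y - x) / 2 > 0"
    using assms by (auto simp: add_eq_0_iff)
  obtain t where t: "0 \<le> t" "t < 2 * pi" "norm (x + y) / 2 = cos t" "norm (y - x) / 2 = sin t"
    using sincos_total_2pi[OF sq] by metis
  have "t < pi" using t pos by (metis not_less sin_le_zero)
  moreover have "t \<noteq> 0" using t pos by auto
  ultimately have "t < pi / 2" using t pos
    by (smt (verit) cos_monotone_0_pi_le cos_pi_half pi_gt_zero field_sum_of_halves)
  then show ?thesis using t \<open>t \<noteq> 0\<close> by (intro that[of t]) auto
qed

text \<open>The arc through the midpoint is minimizing because its length is the angle between its endpoints. Any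
  other minimizing geodesic is a great circle arc too, of half-length at most \<open>\<beta> < pi / 2\<close>; then its
  midpoint and direction can be read off from the sum and the difference of its endpoints.\<close>

lemma geo_eq_great_circle:
  fixes x y :: "'a::euclidean_space"
  assumes x: "norm x = 1" and y: "norm y = 1" and xy: "x \<noteq> y" "y \<noteq> - x"
  obtains \<beta> where "0 < \<beta>" "\<beta> < pi / 2" "cos \<beta> = norm (x + y) / 2" "sin \<beta> = norm (y - x) / 2"
    "\<And>t. t \<in> {-1..1} \<Longrightarrow>
      geo x y t = great_circle ((1 / norm (x + y)) *\<^sub>R (x + y)) ((1 / norm (y - x)) *\<^sub>R (y - x)) \<beta> t"
proof -
  obtain \<beta> where \<beta>: "0 < \<beta>" "\<beta> < pi / 2" and cos: "cos \<beta> = norm (x + y) / 2"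
    and sin: "sin \<beta> = norm (y - x) / 2"
    using half_angle[OF assms] by blast
  define m where "m = (1 / norm (x + y)) *\<^sub>R (x + y)"
  define e where "e = (1 / norm (y - x)) *\<^sub>R (y - x)"
  have nz: "x + y \<noteq> 0" "y - x \<noteq> 0" using xy by (auto simp: add_eq_0_iff)
  have me: "norm m = 1" "norm e = 1" using nz by (simp_all add: m_def e_def)
  have "m \<bullet> e = 0"
    using x y by (simp add: m_def e_def inner_add_left inner_add_right inner_diff_left inner_diff_right inner_commute norm_eq_1)
  note me = me this
  let ?\<sigma> = "great_circle m e \<beta>"
  have ends: "?\<sigma> (-1) = x" "?\<sigma> 1 = y"
    using nz by (simp_all add: great_circle_def cos sin m_def e_def scaleR_left_distrib[symmetric]
        algebra_simps)
  have "cos (2 * \<beta>) = x \<bullet> y"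
    unfolding cos_double_cos using x y by (simp add: cos power_divide power2_norm_eq_inner inner_add_left
        inner_add_right inner_commute norm_eq_1 field_simps)
  then have arc: "arccos (x \<bullet> y) = 2 * \<beta>" using \<beta> arccos_cos[of "2 * \<beta>"] by simp
  have \<sigma>_min: "minimizing_geodesic ?\<sigma>"
    unfolding minimizing_geodesic_def
  proof (intro conjI allI impI)
    show "geodesic_on {-1..1} ?\<sigma>" using me by (rule geodesic_on_great_circle)
    fix c assume "C1_curve c \<and> c ` {-1..1} \<subseteq> sphere 0 1 \<and> c (-1) = ?\<sigma> (-1) \<and> c 1 = ?\<sigma> 1"
    then have "2 * \<beta> \<le> curve_length c"
      using arccos_le_curve_length[of c] by (simp only: ends arc)
    then show "curve_length ?\<sigma> \<le> curve_length c"
      using curve_length_great_circle[OF me, of \<beta> ?\<sigma>] \<beta> by simp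
  qed
  then have "minimizing_geodesic ?\<sigma> \<and> ?\<sigma> (-1) = x \<and> ?\<sigma> 1 = y" using ends by blast
  then have "minimizing_geodesic (geo x y) \<and> geo x y (-1) = x \<and> geo x y 1 = y"
    unfolding geo_def by (rule someI[where P="\<lambda>\<gamma>. minimizing_geodesic \<gamma> \<and> \<gamma> (-1) = x \<and> \<gamma> 1 = y"])
  then have geo: "minimizing_geodesic (geo x y)" "geo x y (-1) = x" "geo x y 1 = y" by auto
  have "geodesic_on {-1..1} (geo x y)" using geo(1) by (simp add: minimizing_geodesic_def)
  from this obtain k p q where pq: "norm p = 1" "p \<bullet> q = 0" "k = 0 \<and> q = 0 \<or> 0 < k \<and> norm q = 1"
    and form: "\<And>t. t \<in> {-1..1} \<Longrightarrow> geo x y t = great_circle p q k t"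
    by (rule geodesic_on_great_circle_form) blast
  have endpq: "x = cos k *\<^sub>R p - sin k *\<^sub>R q" "y = cos k *\<^sub>R p + sin k *\<^sub>R q"
    using form[of "-1"] form[of 1] geo by (simp_all add: great_circle_def)
  have k: "0 < k" "norm q = 1" using pq(3) endpq xy(1) by auto
  have "C1_curve ?\<sigma>"
  proof -
    have v: "velocity ?\<sigma> t = \<beta> *\<^sub>R great_circle e (- m) \<beta> t" if "t \<in> {-1..1}" for t
      by (rule velocity_eqI[OF great_circle_has_vector_derivative that]) simp
    have "continuous_on {-1..1} (\<lambda>t. \<beta> *\<^sub>R great_circle e (- m) \<beta> t)"
      unfolding great_circle_def by (intro continuous_intros)
    then have "continuous_on {-1..1} (velocity ?\<sigma>)"
      by (rule continuous_on_eq) (simp add: v)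
    then show ?thesis
      unfolding C1_curve_def
      using differentiableI_vector[OF great_circle_has_vector_derivative] by blast
  qed
  then have "curve_length (geo x y) \<le> curve_length ?\<sigma>"
    using geo ends norm_great_circle[OF me] unfolding minimizing_geodesic_def by auto
  then have "k \<le> \<beta>"
    using curve_length_great_circle[of p q k "geo x y"] curve_length_great_circle[OF me, of \<beta> ?\<sigma>]
      pq k form \<beta> by simp
  have k2: "k < pi / 2" using \<open>k \<le> \<beta>\<close> \<beta> by simp
  have sum: "x + y = (2 * cos k) *\<^sub>R p" and diff: "y - x = (2 * sin k) *\<^sub>R q"
    unfolding endpq by (simp_all add: scaleR_2 flip: scaleR_scaleR)
  have cs: "cos k > 0" "sin k > 0" using k k2 by (auto intro: cos_gt_zero sin_gt_zero)
  have "norm (x + y) = 2 * cos k" using sum pq cs by simp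
  then have "cos k = cos \<beta>" using cos by simp
  then have kb: "k = \<beta>" using cos_inj_pi[of k \<beta>] k k2 \<beta> by simp
  have "p = m" using sum cs pq by (simp add: m_def)
  moreover have "q = e" using diff cs k by (simp add: e_def)
  ultimately show ?thesis using that[OF \<beta> cos sin] form kb by (simp add: m_def e_def)
qed

lemma geo_midpoint:
  fixes x y :: "'a::euclidean_space"
  assumes "norm x = 1" "norm y = 1" "x \<noteq> y" "y \<noteq> - x"
  shows "geo x y 0 = sgn (x + y)"
  by (rule geo_eq_great_circle[OF assms]) (simp add: great_circle_def sgn_div_norm inverse_eq_divide)

lemma geo_velocity:
  fixes x y :: "'a::euclidean_space"
  assumes x: "norm x = 1" and y: "norm y = 1" and xy: "x \<noteq> y" "y \<noteq> - x"
  obtains r where "r > 0" "velocity (geo x y) (-1) = r *\<^sub>R (y - (x \<bullet> y) *\<^sub>R x)"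
    "velocity (geo x y) 1 = - r *\<^sub>R (x - (x \<bullet> y) *\<^sub>R y)"
proof -
  define m where "m = (1 / norm (x + y)) *\<^sub>R (x + y)"
  define e where "e = (1 / norm (y - x)) *\<^sub>R (y - x)"
  obtain \<beta> where \<beta>: "0 < \<beta>" "\<beta> < pi / 2" and cs: "cos \<beta> = norm (x + y) / 2" "sin \<beta> = norm (y - x) / 2"
    and geo: "\<And>t. t \<in> {-1..1} \<Longrightarrow> geo x y t = great_circle m e \<beta> t"
    unfolding m_def e_def using geo_eq_great_circle[OF assms] by metis
  define c where "c = cos \<beta>"
  define s where "s = sin \<beta>"
  have pos: "c > 0" "s > 0" using \<beta> by (simp_all add: c_def s_def cos_gt_zero sin_gt_zero)
  have "norm (x + y) *\<^sub>R m = x + y" "norm (y - x) *\<^sub>R e = y - x" by (simp_all add: m_def e_def)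
  then have "x + y = (2 * c) *\<^sub>R m" "y - x = (2 * s) *\<^sub>R e"
    by (simp_all add: cs c_def s_def)
  moreover have "2 *\<^sub>R x = (x + y) - (y - x)" "2 *\<^sub>R y = (x + y) + (y - x)" by (simp_all add: scaleR_2)
  ultimately have "2 *\<^sub>R x = 2 *\<^sub>R (c *\<^sub>R m - s *\<^sub>R e)" "2 *\<^sub>R y = 2 *\<^sub>R (c *\<^sub>R m + s *\<^sub>R e)"
    by (simp_all only: scaleR_diff_right scaleR_add_right scaleR_scaleR)
  then have xe: "x = c *\<^sub>R m - s *\<^sub>R e" "y = c *\<^sub>R m + s *\<^sub>R e" by simp_all
  define d where "d = x \<bullet> y"
  have d: "d = 2 * c * c - 1"
    using x y by (simp add: d_def c_def cs power2_norm_eq_inner inner_add_left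
        inner_add_right inner_commute norm_eq_1 field_simps flip: power2_eq_square)
  have ss: "s * s = 1 - c * c" by (simp add: c_def s_def flip: power2_eq_square sin_squared_eq)
  have vel: "velocity (geo x y) t = \<beta> *\<^sub>R great_circle e (- m) \<beta> t" if "t \<in> {-1..1}" for t
    by (rule velocity_eqI[OF great_circle_has_vector_derivative that geo])
  have "y - d *\<^sub>R x = (c - d * c) *\<^sub>R m + (s + d * s) *\<^sub>R e"
    by (simp add: xe algebra_simps)
  also have "c - d * c = 2 * c * s * s" unfolding d mult.assoc ss by (simp add: algebra_simps)
  also have "s + d * s = 2 * c * s * c" unfolding d by (simp add: algebra_simps)
  finally have 1: "y - d *\<^sub>R x = (2 * c * s) *\<^sub>R (c *\<^sub>R e + s *\<^sub>R m)"
    by (simp add: scaleR_add_right add.commute)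
  have "x - d *\<^sub>R y = (c - d * c) *\<^sub>R m - (s + d * s) *\<^sub>R e"
    by (simp add: xe algebra_simps)
  also have "c - d * c = 2 * c * s * s" unfolding d mult.assoc ss by (simp add: algebra_simps)
  also have "s + d * s = 2 * c * s * c" unfolding d by (simp add: algebra_simps)
  finally have 2: "x - d *\<^sub>R y = - (2 * c * s) *\<^sub>R (c *\<^sub>R e - s *\<^sub>R m)"
    by (simp add: scaleR_diff_right)
  show ?thesis unfolding d_def[symmetric]
  proof (rule that[unfolded d_def[symmetric], of "\<beta> / (2 * c * s)"])
    show "\<beta> / (2 * c * s) > 0" using \<beta> pos by simp
    show "velocity (geo x y) (-1) = (\<beta> / (2 * c * s)) *\<^sub>R (y - d *\<^sub>R x)"
      unfolding 1 using pos by (simp add: vel great_circle_def c_def s_def)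
    show "velocity (geo x y) 1 = - (\<beta> / (2 * c * s)) *\<^sub>R (x - d *\<^sub>R y)"
      unfolding 2 using pos by (simp add: vel great_circle_def c_def s_def)
  qed
qed

text \<open>Central projection maps the chord from \<open>x\<close> to \<open>y\<close> onto the minimizing geodesic: the chord point at
  parameter \<open>s\<close> is seen from the origin at the angle \<open>\<tau>\<close> from the midpoint, where
  \<open>tan \<tau> = (2 * s - 1) * tan \<beta>\<close>.\<close>

lemma sgn_segment_in_geo:
  fixes x y :: "'a::euclidean_space"
  assumes x: "norm x = 1" and y: "norm y = 1" and xy: "x \<noteq> y" "y \<noteq> - x" and s: "0 \<le> s" "s \<le> 1"
  shows "sgn ((1 - s) *\<^sub>R x + s *\<^sub>R y) \<in> geo x y ` {-1..1}"
proof -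
  define m where "m = (1 / norm (x + y)) *\<^sub>R (x + y)"
  define e where "e = (1 / norm (y - x)) *\<^sub>R (y - x)"
  obtain \<beta> where \<beta>: "0 < \<beta>" "\<beta> < pi / 2" and cs: "cos \<beta> = norm (x + y) / 2" "sin \<beta> = norm (y - x) / 2"
    and geo: "\<And>t. t \<in> {-1..1} \<Longrightarrow> geo x y t = great_circle m e \<beta> t"
    unfolding m_def e_def using geo_eq_great_circle[OF assms(1-4)] by metis
  have pos: "cos \<beta> > 0" "sin \<beta> > 0" using \<beta> by (simp_all add: cos_gt_zero sin_gt_zero)
  have me: "norm m = 1" "norm e = 1" "m \<bullet> e = 0"
    using pos cs x y by (auto simp: m_def e_def inner_add_left inner_add_right inner_diff_left inner_diff_right inner_commute norm_eq_1)
  define \<tau> where "\<tau> = arctan ((2 * s - 1) * tan \<beta>)"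
  have tan: "tan \<beta> > 0" using \<beta> by (simp add: tan_gt_zero)
  have "\<bar>(2 * s - 1) * tan \<beta>\<bar> \<le> tan \<beta>"
    using s tan by (simp add: abs_mult mult_le_cancel_right1 abs_le_iff)
  then have "arctan (- tan \<beta>) \<le> \<tau>" "\<tau> \<le> arctan (tan \<beta>)"
    unfolding \<tau>_def by (simp_all only: arctan_le_iff abs_le_iff) linarith+
  then have \<tau>: "\<bar>\<tau>\<bar> \<le> \<beta>" using \<beta> by (simp add: arctan_tan arctan_minus abs_le_iff)
  have cost: "cos \<tau> > 0" unfolding \<tau>_def by (intro cos_gt_zero_pi arctan_lbound arctan_ubound)
  have tant: "(2 * s - 1) * sin \<beta> = cos \<beta> * tan \<tau>"
    using pos by (simp add: \<tau>_def tan_arctan) (simp add: tan_def)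
  have "norm (x + y) *\<^sub>R m = x + y" "norm (y - x) *\<^sub>R e = y - x" by (simp_all add: m_def e_def)
  then have "x + y = (2 * cos \<beta>) *\<^sub>R m" "y - x = (2 * sin \<beta>) *\<^sub>R e"
    by (simp_all add: cs)
  moreover have "2 *\<^sub>R ((1 - s) *\<^sub>R x + s *\<^sub>R y) = (x + y) + (2 * s - 1) *\<^sub>R (y - x)"
    by (simp add: algebra_simps scaleR_2)
  ultimately have "2 *\<^sub>R ((1 - s) *\<^sub>R x + s *\<^sub>R y) = 2 *\<^sub>R (cos \<beta> *\<^sub>R m + ((2 * s - 1) * sin \<beta>) *\<^sub>R e)"
    by (simp add: algebra_simps)
  then have "(1 - s) *\<^sub>R x + s *\<^sub>R y = cos \<beta> *\<^sub>R m + ((2 * s - 1) * sin \<beta>) *\<^sub>R e" by simp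
  also have "\<dots> = (cos \<beta> / cos \<tau>) *\<^sub>R great_circle m e 1 \<tau>"
    unfolding tant using cost by (simp add: great_circle_def tan_def algebra_simps)
  finally have "sgn ((1 - s) *\<^sub>R x + s *\<^sub>R y) = sgn (great_circle m e 1 \<tau>)"
    using cost pos by (simp add: sgn_scaleR)
  also have "\<dots> = great_circle m e 1 \<tau>"
    using norm_great_circle[OF me] by (simp add: sgn_div_norm)
  also have "\<dots> = great_circle m e \<beta> (\<tau> / \<beta>)"
    using \<beta> by (simp add: great_circle_def)
  also have "\<dots> = geo x y (\<tau> / \<beta>)"
    using \<tau> \<beta> by (subst geo) (auto simp: field_simps abs_le_iff)
  finally show ?thesis
    using \<tau> \<beta> by (auto simp: image_iff abs_le_iff divide_simps intro!: bexI[of _ "\<tau> / \<beta>"])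
qed

section \<open>First and second derivatives along curves on the sphere\<close>

lemma differential_has_derivative:
  "u differentiable (at x within sphere 0 1) \<Longrightarrow> (u has_derivative differential u x) (at x within sphere 0 1)"
  unfolding differential_def by (simp add: frechet_derivative_works)

lemma differential_linear:
  "u differentiable (at x within sphere 0 1) \<Longrightarrow> linear (differential u x)"
  using differential_has_derivative has_derivative_linear by blast

text \<open>A derivative within the sphere is unique only on tangent vectors, so \<^const>\<open>differential\<close> is one of many
  possible choices. The chain rule holds for each of them.\<close>

lemma sphere_chain_rule:
  assumes "u differentiable (at (c t) within sphere 0 1)" "\<And>s. s \<in> T \<Longrightarrow> c s \<in> sphere 0 1"
    and "(c has_vector_derivative v) (at t within T)"
  shows "((\<lambda>s. u (c s)) has_vector_derivative differential u (c t) v) (at t within T)"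
proof -
  have "(u has_derivative differential u (c t)) (at (c t) within c ` T)"
    using differential_has_derivative[OF assms(1)] assms(2)
    by (meson has_derivative_subset image_subsetI)
  from diff_chain_within[OF assms(3)[unfolded has_vector_derivative_def] this]
  show ?thesis
    by (simp add: has_vector_derivative_def o_def linear_scale[OF differential_linear[OF assms(1)]])
qed

text \<open>The gradient is the tangential part of the vector that represents the differential.\<close>

lemma grad_works:
  assumes "norm x = 1" "u differentiable (at x within sphere 0 1)"
  shows "grad u x \<bullet> x = 0" "\<And>v. v \<bullet> x = 0 \<Longrightarrow> grad u x \<bullet> v = differential u x v"
proof -
  let ?D = "differential u x"
  let ?P = "\<lambda>g. g \<in> tangent_space x \<and> (\<forall>v\<in>tangent_space x. g \<bullet> v = ?D v)"
  let ?g = "tangent_proj x (adjoint ?D 1)"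
  have "?P ?g"
    using assms adjoint_works[OF differential_linear[OF assms(2)], of _ 1]
    by (auto simp: tangent_space_def tangent_proj_def inner_diff_left inner_diff_right norm_eq_1 inner_commute)
  moreover have "g = g'" if "?P g" "?P g'" for g g'
  proof -
    have "g - g' \<in> tangent_space x" using that by (simp add: tangent_space_def inner_diff_left)
    then have "(g - g') \<bullet> (g - g') = 0" using that by (simp add: inner_diff_left)
    then show ?thesis by simp
  qed
  ultimately have "?P (grad u x)" unfolding grad_def using theI[of ?P ?g] by blast
  then show "grad u x \<bullet> x = 0" "\<And>v. v \<bullet> x = 0 \<Longrightarrow> grad u x \<bullet> v = ?D v"
    by (auto simp: tangent_space_def)
qed

lemma grad_chain_rule:
  fixes u :: "'a::euclidean_space \<Rightarrow> real"
  assumes "u differentiable (at (c t) within sphere 0 1)" "\<And>s. s \<in> T \<Longrightarrow> c s \<in> sphere 0 1" "t \<in> T"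
    and "(c has_vector_derivative v) (at t within T)" "v \<bullet> c t = 0"
  shows "((\<lambda>s. u (c s)) has_real_derivative grad u (c t) \<bullet> v) (at t within T)"
proof -
  have "norm (c t) = 1" using assms(2,3) by auto
  then show ?thesis
    using sphere_chain_rule[OF assms(1,2,4)] grad_works(2)[of "c t" u v] assms(1,5)
    by (simp add: has_real_derivative_iff_has_vector_derivative)
qed

lemma hess_linear:
  assumes "grad u differentiable (at x within sphere 0 1)"
  shows "linear (hess u x)"
  using differential_linear[OF assms]
  unfolding hess_def cov_deriv_def tangent_proj_def linear_iff
  by (simp add: inner_add_left algebra_simps)

text \<open>\<open>a\<close> and \<open>b\<close> are the first and second derivative of \<open>\<phi>\<close> at 0. The second derivative is required at the
  single point 0 only, which is what differentiability of the gradient field at one point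
  provides.\<close>

definition jet2 :: "(real \<Rightarrow> real) \<Rightarrow> real \<Rightarrow> real \<Rightarrow> bool" where
  "jet2 \<phi> a b \<longleftrightarrow> (\<exists>\<phi>'. (\<forall>\<^sub>F t in nhds 0. (\<phi> has_real_derivative \<phi>' t) (at t)) \<and> \<phi>' 0 = a \<and>
     (\<phi>' has_real_derivative b) (at 0))"

lemma jet2_diff_average:
  assumes "jet2 \<phi> a b" "jet2 \<psi> a1 b1" "jet2 \<omega> a2 b2"
  shows "jet2 (\<lambda>t. \<phi> t - (\<psi> t + \<omega> t) / 2) (a - (a1 + a2) / 2) (b - (b1 + b2) / 2)"
proof -
  obtain \<phi>' \<psi>' \<omega>' where
    ev: "\<forall>\<^sub>F t in nhds 0. (\<phi> has_real_derivative \<phi>' t) (at t)"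
      "\<forall>\<^sub>F t in nhds 0. (\<psi> has_real_derivative \<psi>' t) (at t)"
      "\<forall>\<^sub>F t in nhds 0. (\<omega> has_real_derivative \<omega>' t) (at t)"
    and a: "\<phi>' 0 = a" "\<psi>' 0 = a1" "\<omega>' 0 = a2"
    and b: "(\<phi>' has_real_derivative b) (at 0)" "(\<psi>' has_real_derivative b1) (at 0)"
      "(\<omega>' has_real_derivative b2) (at 0)"
    using assms unfolding jet2_def by blast
  have "\<forall>\<^sub>F t in nhds 0. ((\<lambda>t. \<phi> t - (\<psi> t + \<omega> t) / 2) has_real_derivative
      \<phi>' t - (\<psi>' t + \<omega>' t) / 2) (at t)"
    using ev by eventually_elim (auto intro!: derivative_eq_intros)
  moreover have "((\<lambda>t. \<phi>' t - (\<psi>' t + \<omega>' t) / 2) has_real_derivative b - (b1 + b2) / 2) (at 0)"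
    using b by (auto intro!: derivative_eq_intros)
  ultimately show ?thesis
    unfolding jet2_def using a by (intro exI[of _ "\<lambda>t. \<phi>' t - (\<psi>' t + \<omega>' t) / 2"]) auto
qed

lemma jet2_local_min:
  assumes "jet2 \<phi> a b" "\<forall>\<^sub>F t in nhds 0. \<phi> 0 \<le> \<phi> t"
  shows "a = 0" "0 \<le> b"
proof -
  obtain \<phi>' where ev: "\<forall>\<^sub>F t in nhds 0. (\<phi> has_real_derivative \<phi>' t) (at t)"
    and a: "\<phi>' 0 = a" and b: "(\<phi>' has_real_derivative b) (at 0)"
    using assms unfolding jet2_def by blast
  obtain d where d: "d > 0" and near: "\<And>t. \<bar>t\<bar> < d \<Longrightarrow> (\<phi> has_real_derivative \<phi>' t) (at t) \<and> \<phi> 0 \<le> \<phi> t"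
    using eventually_conj[OF ev assms(2)] unfolding eventually_nhds_metric by (auto simp: dist_real_def)
  show a0: "a = 0"
    using DERIV_local_min[of \<phi> a 0 d] near d a by auto
  show "0 \<le> b"
  proof (rule ccontr)
    assume "\<not> 0 \<le> b"
    then obtain d' where d': "d' > 0" and neg: "\<And>h. 0 < h \<Longrightarrow> h < d' \<Longrightarrow> \<phi>' h < 0"
      using DERIV_neg_dec_right[OF b] a a0 by auto
    define t where "t = min d d' / 2"
    have t: "0 < t" "t < d" "t < d'" using d d' by (auto simp: t_def)
    obtain z where z: "0 < z" "z < t" "\<phi> t - \<phi> 0 = (t - 0) * \<phi>' z"
      using MVT2[of 0 t \<phi> \<phi>'] near t by auto
    then have "\<phi> t - \<phi> 0 < 0" using neg[of z] t by (simp add: mult_pos_neg)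
    then show False using near[of t] t by simp
  qed
qed

lemma sgn_tangent_line:
  fixes p q :: "'a::euclidean_space"
  assumes "norm p = 1" "q \<bullet> p = 0"
  shows "sgn (p + t *\<^sub>R q) = inverse (sqrt (1 + t\<^sup>2 * (q \<bullet> q))) *\<^sub>R (p + t *\<^sub>R q)"
proof -
  have "norm (p + t *\<^sub>R q) = sqrt (1 + t\<^sup>2 * (q \<bullet> q))"
    using assms by (simp add: norm_eq_sqrt_inner inner_add_left inner_add_right inner_commute
        power2_eq_square)
  then show ?thesis by (simp add: sgn_div_norm)
qed

lemma eventually_sgn_line_in:
  fixes p :: "'a::euclidean_space"
  assumes "openin (top_of_set (sphere 0 1)) \<Omega>" "p \<in> \<Omega>"
  shows "\<forall>\<^sub>F t in nhds 0. sgn (p + t *\<^sub>R q) \<in> \<Omega>"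
proof -
  obtain U where U: "open U" "\<Omega> = sphere 0 1 \<inter> U" using assms(1) by (auto simp: openin_open)
  have p: "norm p = 1" using assms U by auto
  have "((\<lambda>t. p + t *\<^sub>R q) \<longlongrightarrow> p + 0 *\<^sub>R q) (nhds 0)"
    by (intro tendsto_intros filterlim_ident)
  then have lim: "((\<lambda>t. p + t *\<^sub>R q) \<longlongrightarrow> p) (nhds 0)" by simp
  moreover have "p \<noteq> 0" using p by auto
  ultimately have "((\<lambda>t. sgn (p + t *\<^sub>R q)) \<longlongrightarrow> sgn p) (nhds 0)" by (rule tendsto_sgn)
  moreover have "sgn p = p" using p by (simp add: sgn_div_norm)
  ultimately have "\<forall>\<^sub>F t in nhds 0. sgn (p + t *\<^sub>R q) \<in> U"
    using U assms(2) by (auto simp: tendsto_def)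
  moreover have "\<forall>\<^sub>F t in nhds 0. p + t *\<^sub>R q \<noteq> 0"
    using lim \<open>p \<noteq> 0\<close> by (rule tendsto_imp_eventually_ne)
  ultimately show ?thesis
    by eventually_elim (simp add: U(2) norm_sgn)
qed

text \<open>The curve \<open>c t = sgn (p + t *\<^sub>R q)\<close> runs along a great circle and has acceleration \<open>- (q \<bullet> q) *\<^sub>R p\<close> at
  time 0. This is normal to the sphere, so the gradient does not enter the second derivative.\<close>

lemma jet2_along_sgn_line:
  fixes p q :: "'a::euclidean_space" and u :: "'a \<Rightarrow> real"
  assumes op: "openin (top_of_set (sphere 0 1)) \<Omega>" and C2: "C2_on \<Omega> u"
    and p: "p \<in> \<Omega>" and q: "q \<bullet> p = 0"
  shows "jet2 (\<lambda>t. u (sgn (p + t *\<^sub>R q))) (grad u p \<bullet> q) (hess u p q \<bullet> q)"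
proof -
  have sub: "\<Omega> \<subseteq> sphere 0 1" using op openin_imp_subset by blast
  then have np: "norm p = 1" using p by auto
  define r where "r t = inverse (sqrt (1 + t\<^sup>2 * (q \<bullet> q)))" for t
  define c where "c t = r t *\<^sub>R (p + t *\<^sub>R q)" for t
  define c' where "c' t = r t *\<^sub>R q - (t * (q \<bullet> q) * (r t) ^ 3) *\<^sub>R (p + t *\<^sub>R q)" for t
  have c: "sgn (p + t *\<^sub>R q) = c t" for t
    using sgn_tangent_line[OF np q] by (simp add: c_def r_def)
  have pos: "1 + t\<^sup>2 * (q \<bullet> q) > 0" for t by (simp add: add_pos_nonneg)
  have r2: "(r t)\<^sup>2 * (1 + t\<^sup>2 * (q \<bullet> q)) = 1" for t
    using pos[of t] by (simp add: r_def power_inverse)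
  have dr: "(r has_real_derivative - (t * (q \<bullet> q) * (r t) ^ 3)) (at t)" for t
    unfolding r_def using pos[of t]
    by (auto intro!: derivative_eq_intros simp: field_simps power3_eq_cube power2_eq_square)
  have r0: "r 0 = 1" by (simp add: r_def)
  have dc: "(c has_vector_derivative c' t) (at t)" for t
    unfolding c_def c'_def by (auto intro!: derivative_eq_intros dr simp: algebra_simps)
  have "((\<lambda>t. r t *\<^sub>R q - (t * (q \<bullet> q) * (r t) ^ 3) *\<^sub>R (p + t *\<^sub>R q)) has_vector_derivative
      - (q \<bullet> q) *\<^sub>R p) (at 0)"
    by (auto intro!: derivative_eq_intros dr simp: r0)
  then have dc': "(c' has_vector_derivative - (q \<bullet> q) *\<^sub>R p) (at 0)"
    by (simp add: c'_def[abs_def])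
  have c0: "c 0 = p" "c' 0 = q" by (simp_all add: c_def c'_def r0)
  have nc: "norm (c t) = 1" for t
  proof -
    have "p + t *\<^sub>R q \<noteq> 0"
    proof
      assume "p + t *\<^sub>R q = 0"
      then have "(p + t *\<^sub>R q) \<bullet> p = 0" by simp
      then show False using np q by (simp add: inner_add_left norm_eq_1)
    qed
    then show ?thesis by (simp add: c[symmetric] norm_sgn)
  qed
  have tang: "c' t \<bullet> c t = 0" for t
  proof -
    have "c' t \<bullet> c t = (r t)\<^sup>2 * t * (q \<bullet> q) * (1 - (r t)\<^sup>2 * (1 + t\<^sup>2 * (q \<bullet> q)))"
      using np q
      by (simp add: c_def c'_def inner_add_left inner_add_right inner_diff_left inner_commute
          norm_eq_1 algebra_simps power2_eq_square power3_eq_cube)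
    then show ?thesis using r2[of t] by simp
  qed
  have ev: "\<forall>\<^sub>F t in nhds 0. c t \<in> \<Omega>"
    using eventually_sgn_line_in[OF op p, of q] by (simp add: c)
  have dphi: "((\<lambda>t. u (c t)) has_real_derivative grad u (c t) \<bullet> c' t) (at t)" if "c t \<in> \<Omega>" for t
    using grad_chain_rule[of u c t UNIV "c' t"] that C2 dc tang nc by (auto simp: C2_on_def)
  have dg: "((\<lambda>t. grad u (c t)) has_vector_derivative differential (grad u) p q) (at 0)"
    using sphere_chain_rule[of "grad u" c 0 UNIV "c' 0"] C2 p nc dc[of 0] by (auto simp: C2_on_def c0)
  have "((\<lambda>t. grad u (c t) \<bullet> c' t) has_vector_derivative
      grad u (c 0) \<bullet> (- (q \<bullet> q) *\<^sub>R p) + differential (grad u) p q \<bullet> c' 0) (at 0)"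
    by (rule bounded_bilinear.has_vector_derivative[OF bounded_bilinear_inner dg dc'])
  moreover have "grad u p \<bullet> p = 0"
    using grad_works(1)[OF np] C2 p by (auto simp: C2_on_def)
  moreover have "hess u p q \<bullet> q = differential (grad u) p q \<bullet> q"
    using q by (simp add: hess_def cov_deriv_def tangent_proj_def inner_diff_left inner_diff_right inner_commute)
  ultimately have "((\<lambda>t. grad u (c t) \<bullet> c' t) has_real_derivative hess u p q \<bullet> q) (at 0)"
    by (simp add: c0 has_real_derivative_iff_has_vector_derivative)
  moreover have "\<forall>\<^sub>F t in nhds 0. ((\<lambda>t. u (c t)) has_real_derivative grad u (c t) \<bullet> c' t) (at t)"
    using ev by eventually_elim (rule dphi)
  ultimately show ?thesis
    unfolding jet2_def c by (intro exI[of _ "\<lambda>t. grad u (c t) \<bullet> c' t"]) (simp add: c0)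
qed

section \<open>Orthogonal diagonalization of symmetric matrices\<close>

text \<open>A maximiser of the quadratic form \<open>x \<bullet> L x\<close> on the unit sphere of \<open>S\<close> is an eigenvector.\<close>

lemma self_adjoint_eigenvector:
  fixes L :: "'a::euclidean_space \<Rightarrow> 'a"
  assumes lin: "linear L" and sa: "\<And>x y. L x \<bullet> y = x \<bullet> L y"
    and S: "subspace S" and inv: "\<And>x. x \<in> S \<Longrightarrow> L x \<in> S" and nz: "S \<noteq> {0}"
  obtains b c where "b \<in> S" "norm b = 1" "L b = c *\<^sub>R b"
proof -
  define K where "K = S \<inter> sphere 0 1"
  obtain z where z: "z \<in> S" "z \<noteq> 0" using nz S subspace_0 by blast
  have "(1 / norm z) *\<^sub>R z \<in> K"
    using z S by (simp add: K_def subspace_scale)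
  then have "K \<noteq> {}" by blast
  moreover have "compact K"
    unfolding K_def using closed_subspace[OF S] by (simp add: closed_Int_compact)
  moreover have cL: "continuous_on K L"
    using lin by (simp add: linear_continuous_on linear_linear)
  then have "continuous_on K (\<lambda>x. x \<bullet> L x)"
    by (intro continuous_intros)
  ultimately obtain b where b: "b \<in> K" and max: "\<And>x. x \<in> K \<Longrightarrow> x \<bullet> L x \<le> b \<bullet> L b"
    using continuous_attains_sup by metis
  define c where "c = b \<bullet> L b"
  have bS: "b \<in> S" "norm b = 1" using b by (auto simp: K_def)
  have hom: "x \<bullet> L x \<le> c * (norm x)\<^sup>2" if "x \<in> S" for x
  proof (cases "x = 0")
    case False
    have "(1 / norm x) *\<^sub>R x \<in> K" using that S False by (simp add: K_def subspace_scale)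
    from max[OF this] have "(x \<bullet> L x) / (norm x)\<^sup>2 \<le> c"
      by (simp add: c_def linear_scale[OF lin] power2_eq_square divide_simps)
    then show ?thesis using False by (simp add: divide_simps)
  qed (simp add: linear_0[OF lin])
  define w where "w = L b - c *\<^sub>R b"
  have wS: "w \<in> S" using bS inv S by (simp add: w_def subspace_diff subspace_scale)
  have wb: "w \<bullet> b = 0" using bS by (simp add: w_def c_def algebra_simps norm_eq_1 inner_commute)
  have ww: "w \<bullet> L b = w \<bullet> w" using wb by (simp add: w_def algebra_simps inner_commute)
  \<comment> \<open>Moving from the maximiser in the direction of \<open>w\<close> increases the quadratic form to first
    order by \<open>2 * t * (w \<bullet> w)\<close>, against an error of order \<open>t\<^sup>2\<close>.\<close>
  define D where "D = c * (w \<bullet> w) - w \<bullet> L w"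
  have key: "2 * t * (w \<bullet> w) \<le> t\<^sup>2 * D" for t
  proof -
    have "b + t *\<^sub>R w \<in> S" using bS wS S by (simp add: subspace_add subspace_scale)
    from hom[OF this]
    have "(b + t *\<^sub>R w) \<bullet> L (b + t *\<^sub>R w) \<le> c * ((b + t *\<^sub>R w) \<bullet> (b + t *\<^sub>R w))"
      by (simp add: power2_norm_eq_inner)
    moreover have "(b + t *\<^sub>R w) \<bullet> L (b + t *\<^sub>R w) = c + 2 * t * (w \<bullet> w) + t\<^sup>2 * (w \<bullet> L w)"
      using ww sa[of b w]
      by (simp add: linear_add[OF lin] linear_scale[OF lin] algebra_simps c_def power2_eq_square
          inner_commute)
    moreover have "(b + t *\<^sub>R w) \<bullet> (b + t *\<^sub>R w) = 1 + t\<^sup>2 * (w \<bullet> w)"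
      using wb bS by (simp add: algebra_simps norm_eq_1 power2_eq_square inner_commute)
    ultimately have "c + 2 * t * (w \<bullet> w) + t\<^sup>2 * (w \<bullet> L w) \<le> c * (1 + t\<^sup>2 * (w \<bullet> w))"
      by metis
    then show ?thesis by (simp add: D_def algebra_simps)
  qed
  have "w \<bullet> w \<le> 0"
  proof (rule ccontr)
    assume neg: "\<not> w \<bullet> w \<le> 0"
    define t where "t = (w \<bullet> w) / (\<bar>D\<bar> + 1)"
    have t: "t > 0" using neg unfolding t_def by (intro divide_pos_pos) auto
    have "t * (2 * (w \<bullet> w)) \<le> t * (t * D)" using key[of t] by (simp add: power2_eq_square algebra_simps)
    then have "2 * (w \<bullet> w) \<le> t * D" using t by simp
    also have "\<dots> \<le> t * (\<bar>D\<bar> + 1)" using t by (intro mult_left_mono) auto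
    also have "\<dots> = w \<bullet> w" by (simp add: t_def)
    finally show False using neg by simp
  qed
  then have "w = 0" by (metis inner_gt_zero_iff not_le)
  then show ?thesis using that bS by (simp add: w_def)
qed

text \<open>The orthogonal complement of an eigenvector within \<open>S\<close> is again invariant, which allows induction on
  the dimension.\<close>

lemma self_adjoint_eigenbasis:
  fixes L :: "'a::euclidean_space \<Rightarrow> 'a"
  assumes lin: "linear L" and sa: "\<And>x y. L x \<bullet> y = x \<bullet> L y"
    and S: "subspace S" and inv: "\<And>x. x \<in> S \<Longrightarrow> L x \<in> S"
  shows "\<exists>B. pairwise orthogonal B \<and> span B = S \<and> (\<forall>b\<in>B. norm b = 1 \<and> (\<exists>c. L b = c *\<^sub>R b))"
  using S inv
proof (induction "dim S" arbitrary: S rule: less_induct)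
  case less
  show ?case
  proof (cases "S = {0}")
    case True
    show ?thesis by (rule exI[of _ "{}"]) (simp add: True)
  next
    case False
    obtain b c where b: "b \<in> S" "norm b = 1" "L b = c *\<^sub>R b"
      using self_adjoint_eigenvector[OF lin sa less.prems(1)] less.prems(2) False by metis
    define S' where "S' = S \<inter> {x. b \<bullet> x = 0}"
    have S': "subspace S'"
      unfolding S'_def using less.prems(1) subspace_hyperplane[of b] by (rule subspace_inter)
    have "b \<notin> S'" using b by (auto simp: S'_def)
    then have "S' \<subset> S" using b(1) unfolding S'_def by blast
    then have "dim S' < dim S"
      using S' less.prems(1) by (metis dim_psubset span_eq_iff)
    moreover have "L x \<in> S'" if "x \<in> S'" for x
      using that less.prems(2) sa[of b x] b by (simp add: S'_def)
    ultimately obtain B where B: "pairwise orthogonal B" "span B = S'"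
      "\<forall>b\<in>B. norm b = 1 \<and> (\<exists>c. L b = c *\<^sub>R b)"
      using less.hyps S' by metis
    have BS: "B \<subseteq> S'" using B span_superset by blast
    have "pairwise orthogonal (insert b B)"
      using B(1) BS by (auto simp: pairwise_insert S'_def orthogonal_def inner_commute)
    moreover have "span (insert b B) = S"
    proof
      show "span (insert b B) \<subseteq> S"
        using less.prems(1) b BS by (intro span_minimal) (auto simp: S'_def)
      show "S \<subseteq> span (insert b B)"
      proof
        fix x assume x: "x \<in> S"
        have "x - (b \<bullet> x) *\<^sub>R b \<in> S'"
          using x b less.prems(1)
          by (simp add: S'_def subspace_diff subspace_scale algebra_simps norm_eq_1)
        then show "x \<in> span (insert b B)"
          using B(2) by (auto simp: span_insert)
      qed
    qed
    ultimately show ?thesis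
      using B(3) b by (intro exI[of _ "insert b B"]) auto
  qed
qed

lemma conjugate_entry:
  fixes A :: "real^'n^'n"
  shows "(transpose Q ** A ** Q) $ i $ j = column i Q \<bullet> (A *v column j Q)"
proof -
  have "(transpose Q ** A ** Q) $ i $ j = (transpose Q ** (A ** Q)) $ i $ j"
    by (simp add: matrix_mul_assoc)
  also have "\<dots> = (\<Sum>k\<in>UNIV. column i Q $ k * (A *v column j Q) $ k)"
    by (simp add: matrix_matrix_mult_def matrix_vector_mult_def transpose_def column_def)
  also have "\<dots> = column i Q \<bullet> (A *v column j Q)"
    by (simp add: inner_vec_def)
  finally show ?thesis .
qed

lemma symmetric_matrix_diagonalizable:
  fixes A :: "real^'n^'n"
  assumes "transpose A = A"
  obtains Q \<alpha> where "orthogonal_matrix Q" "transpose Q ** A ** Q = diag_matrix \<alpha>"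
proof -
  have sa: "(A *v x) \<bullet> y = x \<bullet> (A *v y)" for x y
    using assms by (metis dot_lmul_matrix vector_transpose_matrix)
  obtain B where B: "pairwise orthogonal B" "span B = (UNIV :: (real^'n) set)"
    "\<forall>b\<in>B. norm b = 1 \<and> (\<exists>c. A *v b = c *\<^sub>R b)"
    using self_adjoint_eigenbasis[of "(*v) A" UNIV] sa by (auto simp: )
  have "0 \<notin> B" using B(3) by force
  then have ind: "independent B" using B(1) pairwise_orthogonal_independent by blast
  then have fin: "finite B" using independent_imp_finite by blast
  have "card B = dim (UNIV :: (real^'n) set)"
    using B(2) ind by (metis dim_span_eq_card_independent)
  then have "card B = CARD('n)" by simp
  then obtain q where q: "bij_betw q (UNIV :: 'n set) B"
    using fin by (metis finite_same_card_bij finite_class.finite_UNIV)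
  obtain c where c: "\<And>b. b \<in> B \<Longrightarrow> A *v b = c b *\<^sub>R b" using B(3) by metis
  define Q where "Q = (\<chi> i j. q j $ i)"
  have col: "column j Q = q j" for j by (simp add: Q_def column_def vec_eq_iff)
  have on: "q i \<bullet> q j = (if i = j then 1 else 0)" for i j
  proof (cases "i = j")
    case True
    then show ?thesis using B(3) q by (simp add: bij_betwE norm_eq_1[symmetric])
  next
    case False
    then have "q i \<noteq> q j" using q by (auto simp: bij_betw_def inj_on_def)
    then show ?thesis using B(1) q False by (auto simp: pairwise_def orthogonal_def bij_betwE)
  qed
  have "transpose Q ** Q = mat 1"
    using conjugate_entry[of Q "mat 1"] by (simp add: vec_eq_iff col on) (simp add: mat_def)
  then have "orthogonal_matrix Q" by (simp add: orthogonal_matrix)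
  moreover have "transpose Q ** A ** Q = diag_matrix (\<chi> j. c (q j))"
    using q by (simp add: vec_eq_iff conjugate_entry col on c bij_betwE diag_matrix_def)
  ultimately show ?thesis using that by blast
qed

lemma matrix_sub_ldistrib: "A ** (B - C) = A ** B - A ** C" for A B C :: "real^'n^'n"
  by (simp add: matrix_matrix_mult_def vec_eq_iff right_diff_distrib sum_subtractf)

lemma matrix_sub_rdistrib: "(B - C) ** A = B ** A - C ** A" for A B C :: "real^'n^'n"
  by (simp add: matrix_matrix_mult_def vec_eq_iff left_diff_distrib sum_subtractf)

lemma det_conjugate_orthogonal:
  assumes "orthogonal_matrix (Q :: real^'n^'n)"
  shows "det (mat s - transpose Q ** A ** Q) = det (mat s - A)"
proof -
  have Q: "transpose Q ** Q = mat 1" using assms by (simp add: orthogonal_matrix)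
  have "transpose Q ** mat s ** Q = mat s"
  proof -
    have "mat s = s *\<^sub>R (mat 1 :: real^'n^'n)" by (simp add: mat_def vec_eq_iff)
    then show ?thesis
      using Q by (metis matrix_mul_rid matrix_scalar_ac scalar_matrix_assoc matrix_mul_assoc)
  qed
  then have "mat s - transpose Q ** A ** Q = transpose Q ** (mat s - A) ** Q"
    by (simp add: matrix_sub_ldistrib matrix_sub_rdistrib)
  then have "det (mat s - transpose Q ** A ** Q) = det (transpose Q ** Q) * det (mat s - A)"
    by (simp add: det_mul)
  then show ?thesis by (simp add: Q)
qed

lemma eigenvalue_tuple_diag: "eigenvalue_tuple (diag_matrix \<alpha>) \<alpha>"
  unfolding eigenvalue_tuple_def
proof
  fix s
  have "det (mat s - diag_matrix \<alpha>) = (\<Prod>i\<in>UNIV. (mat s - diag_matrix \<alpha>) $ i $ i)"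
    by (rule det_diagonal) (simp add: mat_def diag_matrix_def)
  also have "\<dots> = (\<Prod>i\<in>UNIV. s - \<alpha> $ i)"
    by (simp add: mat_def diag_matrix_def)
  finally show "det (mat s - diag_matrix \<alpha>) = (\<Prod>i\<in>UNIV. s - \<alpha> $ i)" .
qed

text \<open>The characteristic polynomial determines the multiset of its roots.\<close>

lemma eigenvalue_tuple_unique:
  fixes A :: "real^'n^'n"
  assumes "eigenvalue_tuple A \<kappa>" "eigenvalue_tuple A \<mu>"
  obtains \<pi> where "\<pi> permutes UNIV" "\<mu> = (\<chi> i. \<kappa> $ \<pi> i)"
proof -
  define P where "P \<kappa> = (\<Prod>i\<in>UNIV. [:- (\<kappa> $ i), 1:])" for \<kappa> :: "real^'n"
  have "poly (P \<kappa>) s = (\<Prod>i\<in>UNIV. s - \<kappa> $ i)" for \<kappa> s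
    by (simp add: P_def poly_prod)
  then have "P \<kappa> = P \<mu>"
    using assms by (simp add: eigenvalue_tuple_def poly_eq_poly_eq_iff[symmetric] fun_eq_iff)
  moreover have "proots (P \<kappa>) = image_mset (\<lambda>i. \<kappa> $ i) (mset_set UNIV)" for \<kappa>
    unfolding P_def
    by (subst proots_prod) (auto simp: sum_unfold_sum_mset)
  ultimately have "image_mset (\<lambda>i. \<kappa> $ i) (mset_set UNIV) = image_mset (\<lambda>i. \<mu> $ i) (mset_set UNIV)"
    by metis
  then obtain \<pi> where "\<pi> permutes UNIV" "\<forall>i\<in>UNIV. \<mu> $ i = \<kappa> $ \<pi> i"
    using image_mset_eq_implies_permutes[of UNIV "\<lambda>i. \<mu> $ i" "\<lambda>i. \<kappa> $ i"] by (auto )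
  then show ?thesis using that by (simp add: vec_eq_iff)
qed

lemma symmetric_set_closure:
  assumes "symmetric_set \<Gamma>"
  shows "symmetric_set (closure \<Gamma>)"
  unfolding symmetric_set_def
proof (intro allI impI)
  fix \<pi> :: "'a \<Rightarrow> 'a" assume \<pi>: "\<pi> permutes UNIV"
  have "(\<lambda>\<kappa>. \<chi> i. \<kappa> $ \<pi> i) ` closure \<Gamma> \<subseteq> closure \<Gamma>"
    using assms \<pi> closure_subset[of \<Gamma>]
    by (intro image_closure_subset) (auto intro!: continuous_intros simp: symmetric_set_def)
  then show "\<forall>\<kappa>\<in>closure \<Gamma>. (\<chi> i. \<kappa> $ \<pi> i) \<in> closure \<Gamma>" by auto
qed

lemma orthogonal_matrix_inv:
  assumes "orthogonal_matrix (Q :: real^'n^'n)"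
  shows "invertible Q" "matrix_inv Q = transpose Q"
proof -
  have Q: "transpose Q ** Q = mat 1" "Q ** transpose Q = mat 1"
    using assms by (simp_all add: orthogonal_matrix_def)
  then show inv: "invertible Q" unfolding invertible_def by blast
  have "matrix_inv Q ** Q = mat 1"
    using inv by (simp add: matrix_inv_def invertible_def) (metis (mono_tags, lifting) someI_ex)
  then have "matrix_inv Q ** (Q ** transpose Q) = transpose Q"
    by (simp add: matrix_mul_assoc)
  then show "matrix_inv Q = transpose Q" by (simp add: Q)
qed

lemma sym_matrices_conjugate:
  assumes "A \<in> sym_matrices K" "orthogonal_matrix Q"
  shows "transpose Q ** A ** Q \<in> sym_matrices K"
  using assms det_conjugate_orthogonal[OF assms(2)]
  by (auto simp: sym_matrices_def eigenvalue_tuple_def matrix_transpose_mul matrix_mul_assoc)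

lemma isotropic_on_conjugate:
  assumes "isotropic_on (sym_matrices K) F" "A \<in> sym_matrices K" "orthogonal_matrix Q"
  shows "F (transpose Q ** A ** Q) = F A"
  using assms(1,2) orthogonal_matrix_inv[OF assms(3)] sym_matrices_conjugate[OF assms(2,3)]
  unfolding isotropic_on_def by metis

section \<open>Convex spectral functions on symmetric matrices\<close>

definition psd :: "real^'n^'n \<Rightarrow> bool" where
  "psd A \<longleftrightarrow> transpose A = A \<and> (\<forall>w. 0 \<le> w \<bullet> (A *v w))"

lemma psd_entry_sym: "psd A \<Longrightarrow> A $ i $ j = A $ j $ i"
  unfolding psd_def by (metis transpose_def vec_lambda_beta)

lemma quadratic_form_conjugate:
  fixes A :: "real^'n^'n"
  shows "w \<bullet> ((transpose Q ** A ** Q) *v w) = (Q *v w) \<bullet> (A *v (Q *v w))"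
proof -
  have "w \<bullet> (transpose Q *v z) = (Q *v w) \<bullet> z" for z
    by (metis dot_lmul_matrix vector_transpose_matrix)
  then show ?thesis by (simp flip: matrix_vector_mul_assoc)
qed

lemma psd_conjugate: "psd A \<Longrightarrow> psd (transpose Q ** A ** Q)"
  unfolding psd_def
  by (simp add: quadratic_form_conjugate matrix_transpose_mul matrix_mul_assoc)

lemma axis_quadratic_form: "axis i 1 \<bullet> (A *v axis i 1) = (A :: real^'n^'n) $ i $ i"
  by (simp add: inner_axis' matrix_vector_mult_basis column_def)

lemma psd_diagonal: "psd A \<Longrightarrow> 0 \<le> A $ i $ i"
  using axis_quadratic_form[of i A] by (metis psd_def)

lemma quadratic_form_sum:
  "w \<bullet> (A *v w) = (\<Sum>i\<in>UNIV. \<Sum>j\<in>UNIV. w $ i * A $ i $ j * w $ j)" for A :: "real^'n^'n"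
  by (simp add: inner_vec_def matrix_vector_mult_def sum_distrib_left mult.assoc)

lemma transpose_diag_matrix [simp]: "transpose (diag_matrix \<alpha>) = diag_matrix \<alpha>"
  by (simp add: transpose_def diag_matrix_def vec_eq_iff)

text \<open>The properties that the function \<open>f p\<close> of the main theorem has for each fixed \<open>p\<close>.\<close>

locale convex_spectral_function =
  fixes \<Gamma> :: "(real^'n) set" and F :: "real^'n^'n \<Rightarrow> real"
  assumes sym: "symmetric_set \<Gamma>"
    and orthant: "{\<kappa>. \<forall>i. \<kappa> $ i > 0} \<subseteq> \<Gamma>"
    and iso: "isotropic_on (sym_matrices (closure \<Gamma>)) F"
    and mono: "\<And>\<kappa> \<mu>. \<kappa> \<in> closure \<Gamma> \<Longrightarrow> \<mu> \<in> closure \<Gamma> \<Longrightarrow> (\<And>i. \<kappa> $ i \<le> \<mu> $ i)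
      \<Longrightarrow> F (diag_matrix \<kappa>) \<le> F (diag_matrix \<mu>)"
    and conv: "\<And>A B. A \<in> sym_matrices (closure \<Gamma>) \<Longrightarrow> B \<in> sym_matrices (closure \<Gamma>)
      \<Longrightarrow> F ((1/2) *\<^sub>R (A + B)) \<le> (F A + F B) / 2"
begin

abbreviation "\<D> \<equiv> sym_matrices (closure \<Gamma>)"

text \<open>A small multiple of the all-ones vector moves such a tuple into the open orthant.\<close>

lemma nonneg_in_closure:
  assumes "\<And>i. 0 \<le> \<kappa> $ i"
  shows "\<kappa> \<in> closure \<Gamma>"
  unfolding closure_approachable
proof (intro allI impI)
  fix e :: real assume e: "e > 0"
  define \<mu> where "\<mu> = \<kappa> + (e / 2 / norm (1 :: real^'n)) *\<^sub>R 1"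
  have n: "norm (1 :: real^'n) > 0" by simp
  have "\<mu> $ i > 0" for i
    using assms[of i] e n by (simp add: \<mu>_def add_nonneg_pos)
  then have "\<mu> \<in> \<Gamma>" using orthant by blast
  moreover have "dist \<mu> \<kappa> < e" using e n by (simp add: \<mu>_def dist_norm)
  ultimately show "\<exists>y\<in>\<Gamma>. dist y \<kappa> < e" by blast
qed

text \<open>The eigenvalues come out of the diagonalization in some order; since \<open>\<Gamma>\<close> is symmetric, every order is
  as good as the one that puts the matrix into the domain.\<close>

lemma diagonalize_domain:
  assumes "A \<in> \<D>"
  obtains Q \<alpha> where "orthogonal_matrix Q" "transpose Q ** A ** Q = diag_matrix \<alpha>" "\<alpha> \<in> closure \<Gamma>"
proof -
  obtain Q \<alpha> where Q: "orthogonal_matrix Q" "transpose Q ** A ** Q = diag_matrix \<alpha>"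
    using assms symmetric_matrix_diagonalizable by (auto simp: sym_matrices_def)
  have "diag_matrix \<alpha> \<in> \<D>" using sym_matrices_conjugate[OF assms Q(1)] Q(2) by simp
  then obtain \<kappa> where "\<kappa> \<in> closure \<Gamma>" "eigenvalue_tuple (diag_matrix \<alpha>) \<kappa>"
    by (auto simp: sym_matrices_def)
  then have "\<alpha> \<in> closure \<Gamma>"
    using eigenvalue_tuple_unique[OF _ eigenvalue_tuple_diag] symmetric_set_closure[OF sym]
    unfolding symmetric_set_def by metis
  then show ?thesis using that Q by blast
qed

lemma psd_in_domain:
  assumes "psd A"
  shows "A \<in> \<D>"
proof -
  obtain Q \<alpha> where Q: "orthogonal_matrix Q" "transpose Q ** A ** Q = diag_matrix \<alpha>"
    using assms symmetric_matrix_diagonalizable by (auto simp: psd_def)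
  have "0 \<le> \<alpha> $ i" for i
    using psd_diagonal[OF psd_conjugate[OF assms, of Q], of i] by (simp add: Q diag_matrix_def)
  then have "\<alpha> \<in> closure \<Gamma>" by (rule nonneg_in_closure)
  moreover have "eigenvalue_tuple A \<alpha>"
    using eigenvalue_tuple_diag[of \<alpha>] det_conjugate_orthogonal[OF Q(1), of _ A] Q(2)
    by (simp add: eigenvalue_tuple_def)
  ultimately show ?thesis using assms by (auto simp: sym_matrices_def psd_def)
qed

end

text \<open>The entries that couple the \<open>k\<close>-th coordinate with the others are multiplied by \<open>d\<close>. This is affine in
  \<open>d\<close>, with \<open>d = 1\<close> giving the matrix itself and \<open>d = -1\<close> its conjugate under the reflection \<open>flip k\<close>.\<close>

definition damp :: "real \<Rightarrow> 'n \<Rightarrow> real^'n^'n \<Rightarrow> real^'n^'n" where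
  "damp d k B = (\<chi> i j. if (i = k) = (j = k) then B $ i $ j else d * B $ i $ j)"

definition flip :: "'n \<Rightarrow> real^'n^'n" where
  "flip k = diag_matrix (\<chi> i. if i = k then -1 else 1)"

lemma diag_matrix_conjugate:
  "(diag_matrix \<alpha> ** B ** diag_matrix \<alpha>) $ i $ j = \<alpha> $ i * B $ i $ j * \<alpha> $ j"
proof -
  have "(diag_matrix \<alpha> ** B) $ i $ l = \<alpha> $ i * B $ i $ l" for l
    by (simp add: matrix_matrix_mult_def diag_matrix_def if_distrib[where f="\<lambda>z. z * _"] sum.delta
        cong: if_cong)
  then show ?thesis
    by (subst matrix_matrix_mult_def)
       (simp add: diag_matrix_def if_distrib sum.delta cong: if_cong)
qed

lemma orthogonal_matrix_flip: "orthogonal_matrix (flip k)"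
proof -
  have "diag_matrix (\<chi> i. if i = k then -1 else 1) ** mat 1 ** diag_matrix (\<chi> i. if i = k then -1 else 1)
    = (mat 1 :: real^'a^'a)"
    unfolding vec_eq_iff diag_matrix_conjugate by (simp add: mat_def)
  then show ?thesis by (simp add: orthogonal_matrix flip_def)
qed

lemma damp_minus_1: "damp (-1) k B = transpose (flip k) ** B ** flip k"
  by (simp add: flip_def vec_eq_iff diag_matrix_conjugate damp_def)

lemma damp_1: "damp 1 k B = B"
  by (simp add: damp_def vec_eq_iff)

lemma damp_midpoint: "damp ((d + e) / 2) k B = (1/2) *\<^sub>R (damp d k B + damp e k B)"
  by (simp add: damp_def vec_eq_iff field_simps)

lemma psd_add_scale:
  assumes "psd A" "psd B" "0 \<le> a" "0 \<le> b"
  shows "psd (a *\<^sub>R A + b *\<^sub>R B)"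
proof -
  have "w \<bullet> ((a *\<^sub>R A + b *\<^sub>R B) *v w) = a * (w \<bullet> (A *v w)) + b * (w \<bullet> (B *v w))" for w
    unfolding quadratic_form_sum sum_distrib_left sum.distrib[symmetric]
    by (simp add: algebra_simps)
  moreover have "transpose (a *\<^sub>R A + b *\<^sub>R B) = a *\<^sub>R A + b *\<^sub>R B"
    using assms(1,2)[THEN psd_entry_sym] by (simp add: transpose_def vec_eq_iff)
  ultimately show ?thesis using assms unfolding psd_def by simp
qed

lemma psd_damp:
  assumes "psd B" "\<bar>d\<bar> \<le> 1"
  shows "psd (damp d k B)"
proof -
  have "damp d k B = ((1 + d) / 2) *\<^sub>R B + ((1 - d) / 2) *\<^sub>R (transpose (flip k) ** B ** flip k)"
    unfolding damp_minus_1[symmetric] by (simp add: damp_def vec_eq_iff field_simps)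
  then show ?thesis using assms by (auto intro!: psd_add_scale psd_conjugate)
qed

context convex_spectral_function
begin

text \<open>Deleting the off-diagonal entries of one row and column is averaging with a reflected copy.\<close>

lemma damp_0_le:
  assumes "psd B"
  shows "F (damp 0 k B) \<le> F B"
proof -
  have B: "B \<in> \<D>" using assms by (rule psd_in_domain)
  have "F (damp 0 k B) \<le> (F B + F (damp (-1) k B)) / 2"
    using damp_midpoint[of 1 "-1" k B] conv[OF B, of "damp (-1) k B"] assms
    by (simp add: damp_1 psd_in_domain psd_damp)
  also have "F (damp (-1) k B) = F B"
    unfolding damp_minus_1 using iso B orthogonal_matrix_flip by (rule isotropic_on_conjugate)
  finally show ?thesis by simp
qed

text \<open>The off-diagonal entries are deleted one row and column at a time.\<close>

lemma diagonal_part_le: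
  assumes "psd B"
  shows "F (diag_matrix (\<chi> i. B $ i $ i)) \<le> F B"
proof -
  define pinch where
    "pinch S = (\<chi> i j. if i = j \<or> (i \<notin> S \<and> j \<notin> S) then B $ i $ j else 0)" for S
  have "psd (pinch S) \<and> F (pinch S) \<le> F B" if "finite S" for S
    using that
  proof (induction S)
    case empty
    have "pinch {} = B" by (simp add: pinch_def vec_eq_iff)
    then show ?case using assms by simp
  next
    case (insert k S)
    have "pinch (insert k S) = damp 0 k (pinch S)"
      by (auto simp: pinch_def damp_def vec_eq_iff)
    then show ?case
      using insert.IH damp_0_le[of "pinch S" k] psd_damp[of "pinch S" 0 k] by simp
  qed
  moreover have "pinch UNIV = diag_matrix (\<chi> i. B $ i $ i)"
    by (auto simp: pinch_def diag_matrix_def vec_eq_iff)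
  ultimately show ?thesis by (metis finite_class.finite_UNIV)
qed

text \<open>In an eigenbasis of \<open>A\<close>, the diagonal entries of \<open>B\<close> dominate the eigenvalues of \<open>A\<close>, and passing from
  \<open>B\<close> to its diagonal part does not increase \<open>F\<close>. The diagonal entries of \<open>B\<close> are nonnegative, so the
  diagonal part lies in the domain.\<close>

lemma mono_psd:
  assumes A: "A \<in> \<D>" and B: "psd B" and le: "\<And>w. w \<bullet> (A *v w) \<le> w \<bullet> (B *v w)"
  shows "F A \<le> F B"
proof -
  obtain Q \<alpha> where Q: "orthogonal_matrix Q" "transpose Q ** A ** Q = diag_matrix \<alpha>"
    and \<alpha>: "\<alpha> \<in> closure \<Gamma>"
    using diagonalize_domain[OF A] by blast
  define C where "C = transpose Q ** B ** Q"
  have C: "psd C" using B by (simp add: C_def psd_conjugate)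
  have "\<alpha> $ i \<le> C $ i $ i" for i
  proof -
    have "\<alpha> $ i = axis i 1 \<bullet> (diag_matrix \<alpha> *v axis i 1)"
      unfolding axis_quadratic_form by (simp add: diag_matrix_def)
    also have "\<dots> = (Q *v axis i 1) \<bullet> (A *v (Q *v axis i 1))"
      unfolding Q(2)[symmetric] quadratic_form_conjugate ..
    also have "\<dots> \<le> (Q *v axis i 1) \<bullet> (B *v (Q *v axis i 1))" by (rule le)
    also have "\<dots> = axis i 1 \<bullet> (C *v axis i 1)"
      unfolding C_def quadratic_form_conjugate ..
    finally show ?thesis by (simp add: axis_quadratic_form)
  qed
  moreover have "(\<chi> i. C $ i $ i) \<in> closure \<Gamma>"
    using psd_diagonal[OF C] by (simp add: nonneg_in_closure)
  ultimately have "F (diag_matrix \<alpha>) \<le> F (diag_matrix (\<chi> i. C $ i $ i))"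
    using \<alpha> by (intro mono) auto
  also have "\<dots> \<le> F C" using C by (rule diagonal_part_le)
  also have "F C = F B" 
    unfolding C_def using iso psd_in_domain[OF B] Q(1) by (rule isotropic_on_conjugate)
  also have "F (diag_matrix \<alpha>) = F A"
    unfolding Q(2)[symmetric] using iso A Q(1) by (rule isotropic_on_conjugate)
  finally show ?thesis .
qed

text \<open>Along the segment of the matrices \<open>damp d k B\<close> with \<open>d\<close> in \<open>{-1..1}\<close>, the function \<open>F\<close> is midpoint convex,
  and it equals \<open>F B\<close> at both ends. It is bounded above, because all these matrices lie below one
  multiple of the identity. Let \<open>T\<close> be its supremum. Each point of the segment is the midpoint of an
  end and another point, so \<open>T \<le> (F B + T) / 2\<close>, that is \<open>T \<le> F B\<close>. The existence of an
  upper bound is what makes the argument work for factors \<open>d\<close> that are not dyadic.\<close>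

lemma damp_le:
  assumes B: "psd B" and d: "\<bar>d\<bar> \<le> 1"
  shows "F (damp d k B) \<le> F B"
proof -
  define g where "g d = F (damp d k B)" for d
  define I where "I = {-1..1::real}"
  have psd: "psd (damp d k B)" if "d \<in> I" for d
    using that B by (intro psd_damp) (auto simp: I_def)
  have mid: "g ((d + e) / 2) \<le> (g d + g e) / 2" if "d \<in> I" "e \<in> I" for d e
    unfolding g_def damp_midpoint using that by (intro conv psd_in_domain psd)
  have ends: "g 1 = F B" "g (-1) = F B"
    using isotropic_on_conjugate[OF iso psd_in_domain[OF B] orthogonal_matrix_flip]
    by (simp_all add: g_def damp_1 damp_minus_1)
  define K where "K = (\<Sum>i\<in>UNIV. \<Sum>j\<in>UNIV. \<bar>B $ i $ j\<bar>)"
  have "g d \<le> F (diag_matrix (\<chi> i. K) :: real^'n^'n)" if d: "d \<in> I" for d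
    unfolding g_def
  proof (rule mono_psd)
    show "damp d k B \<in> \<D>" using d by (intro psd_in_domain psd)
    have K: "K \<ge> 0" by (simp add: K_def sum_nonneg)
    have diag: "w \<bullet> (diag_matrix (\<chi> i. K) *v w) = K * (w \<bullet> w)" for w :: "real^'n"
    proof -
      have "diag_matrix (\<chi> i. K) = K *\<^sub>R (mat 1 :: real^'n^'n)"
        by (simp add: diag_matrix_def mat_def vec_eq_iff)
      then show ?thesis by (simp flip: scaleR_matrix_vector_assoc)
    qed
    show "psd (diag_matrix (\<chi> i. K) :: real^'n^'n)" using K by (simp add: psd_def diag)
    fix w
    have "w \<bullet> (damp d k B *v w) = (\<Sum>i\<in>UNIV. \<Sum>j\<in>UNIV. w $ i * damp d k B $ i $ j * w $ j)"
      by (rule quadratic_form_sum)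
    also have "\<dots> \<le> (\<Sum>i\<in>UNIV. \<Sum>j\<in>UNIV. \<bar>B $ i $ j\<bar> * (w \<bullet> w))"
    proof (intro sum_mono)
      fix i j
      have "\<bar>d * B $ i $ j\<bar> \<le> \<bar>B $ i $ j\<bar>"
        using d by (auto simp: abs_mult I_def intro: mult_left_le_one_le)
      then have 1: "\<bar>damp d k B $ i $ j\<bar> \<le> \<bar>B $ i $ j\<bar>" by (simp add: damp_def)
      have "\<bar>w $ i\<bar> * \<bar>w $ j\<bar> \<le> norm w * norm w"
        using component_le_norm_cart by (intro mult_mono) auto
      then have 2: "\<bar>w $ i\<bar> * \<bar>w $ j\<bar> \<le> w \<bullet> w" by (simp add: power2_norm_eq_inner[symmetric] power2_eq_square)
      have "w $ i * damp d k B $ i $ j * w $ j \<le> \<bar>damp d k B $ i $ j\<bar> * (\<bar>w $ i\<bar> * \<bar>w $ j\<bar>)"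
        by (rule order_trans[OF abs_ge_self]) (simp add: abs_mult)
      also have "\<dots> \<le> \<bar>B $ i $ j\<bar> * (w \<bullet> w)" using 1 2 by (intro mult_mono) auto
      finally show "w $ i * damp d k B $ i $ j * w $ j \<le> \<bar>B $ i $ j\<bar> * (w \<bullet> w)" .
    qed
    also have "\<dots> = K * (w \<bullet> w)" by (simp add: K_def sum_distrib_right)
    also have "\<dots> = w \<bullet> (diag_matrix (\<chi> i. K) *v w)" by (simp only: diag)
    finally show "w \<bullet> (damp d k B *v w) \<le> w \<bullet> (diag_matrix (\<chi> i. K) *v w)" .
  qed
  then have bdd: "bdd_above (g ` I)" by (rule bdd_aboveI2)
  define T where "T = Sup (g ` I)"
  have up: "g e \<le> T" if "e \<in> I" for e using bdd that by (simp add: T_def cSUP_upper)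
  have "g e \<le> (F B + T) / 2" if e: "e \<in> I" for e
  proof (cases "e \<ge> 0")
    case True
    then have "2 * e - 1 \<in> I" using e by (auto simp: I_def)
    then show ?thesis using mid[of 1 "2 * e - 1"] up[of "2 * e - 1"] ends by (simp add: I_def)
  next
    case False
    then have "2 * e + 1 \<in> I" using e by (auto simp: I_def)
    then show ?thesis using mid[of "-1" "2 * e + 1"] up[of "2 * e + 1"] ends by (simp add: I_def)
  qed
  then have "T \<le> (F B + T) / 2" unfolding T_def by (intro cSUP_least) (auto simp: I_def)
  moreover have "g d \<le> T" using d by (intro up) (auto simp: I_def)
  ultimately show ?thesis by (simp add: g_def)
qed

text \<open>Let \<open>K\<close> be the diagonal matrix with entry 1 at \<open>k\<close> and \<open>c\<close> elsewhere, so the hypothesis is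
  \<open>A \<le> K B K\<close>. The matrix \<open>damp c k B - K B K\<close> is \<open>1 - c\<^sup>2\<close> times the block of \<open>B\<close> off the index \<open>k\<close>, which is
  positive semidefinite. Hence \<open>A \<le> damp c k B\<close>, and damping does not increase \<open>F\<close>.\<close>

lemma contraction_le:
  assumes A: "A \<in> \<D>" and B: "psd B" and c: "0 \<le> c" "c \<le> 1"
    and le: "\<And>w w'. (\<And>i. w' $ i = (if i = k then w $ i else c * w $ i)) \<Longrightarrow>
      w \<bullet> (A *v w) \<le> w' \<bullet> (B *v w')"
  shows "F A \<le> F B"
proof -
  have "F A \<le> F (damp c k B)"
  proof (rule mono_psd[OF A])
    show "psd (damp c k B)" using B c by (intro psd_damp) auto
    fix w
    define w' where "w' = (\<chi> i. if i = k then w $ i else c * w $ i)"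
    define v where "v = (\<chi> i. if i = k then 0 else w $ i)"
    have "w \<bullet> (A *v w) \<le> w' \<bullet> (B *v w')" by (rule le) (simp add: w'_def)
    also have "\<dots> \<le> w' \<bullet> (B *v w') + (1 - c\<^sup>2) * (v \<bullet> (B *v v))"
      using B c by (auto simp: psd_def abs_square_le_1 intro!: mult_nonneg_nonneg)
    also have "\<dots> = w \<bullet> (damp c k B *v w)"
      unfolding quadratic_form_sum sum_distrib_left sum.distrib[symmetric]
      by (intro sum.cong refl) (simp add: w'_def v_def damp_def power2_eq_square algebra_simps)
    finally show "w \<bullet> (A *v w) \<le> w \<bullet> (damp c k B *v w)" .
  qed
  also have "\<dots> \<le> F B" using B c by (intro damp_le) auto
  finally show ?thesis .
qed

end

section \<open>Orthonormal frames of tangent spaces\<close>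

lemma orthonormal_frame_expansion:
  fixes e :: "'n::finite \<Rightarrow> 'a::euclidean_space"
  assumes e: "orthonormal_frame x e" and v: "v \<bullet> x = 0"
  shows "v = (\<Sum>i\<in>UNIV. (e i \<bullet> v) *\<^sub>R e i)"
proof -
  have on: "e i \<bullet> e j = (if i = j then 1 else 0)" for i j
    using e by (simp add: orthonormal_frame_def)
  have sp: "span (range e) = tangent_space x" using e by (simp add: orthonormal_frame_def)
  define w where "w = v - (\<Sum>i\<in>UNIV. (e i \<bullet> v) *\<^sub>R e i)"
  have "orthogonal w b" if b: "b \<in> range e" for b
  proof -
    from b obtain j where b: "b = e j" by blast
    have "(\<Sum>i\<in>UNIV. (e i \<bullet> v) *\<^sub>R e i) \<bullet> e j = (\<Sum>i\<in>UNIV. if i = j then e i \<bullet> v else 0)"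
      unfolding inner_sum_left by (intro sum.cong) (auto simp: on)
    then show ?thesis by (simp add: b w_def orthogonal_def inner_diff_left inner_diff_right inner_commute)
  qed
  moreover have "v \<in> span (range e)" using v sp by (simp add: tangent_space_def)
  then have "w \<in> span (range e)"
    unfolding w_def by (intro span_diff span_sum span_scale) (auto intro: span_base)
  ultimately have "orthogonal w w" by (metis orthogonal_to_span)
  then show ?thesis by (simp add: w_def orthogonal_def)
qed

lemma orthonormal_frame_tangent:
  assumes "orthonormal_frame x e"
  shows "e i \<bullet> x = 0"
proof -
  have "e i \<in> tangent_space x"
    using assms span_base[of "e i" "range e"] by (simp add: orthonormal_frame_def)
  then show ?thesis by (simp add: tangent_space_def)
qed

lemma orthonormal_frame_norm:
  fixes e :: "'n::finite \<Rightarrow> 'a::euclidean_space"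
  assumes "orthonormal_frame x e" "v \<bullet> x = 0"
  shows "(norm v)\<^sup>2 = (\<Sum>i\<in>UNIV. (v \<bullet> e i)\<^sup>2)"
proof -
  have "v \<bullet> v = v \<bullet> (\<Sum>i\<in>UNIV. (e i \<bullet> v) *\<^sub>R e i)"
    using orthonormal_frame_expansion[OF assms] by simp
  then show ?thesis
    unfolding power2_norm_eq_inner by (simp add: inner_sum_right power2_eq_square inner_commute)
qed

definition frame_matrix :: "('n::finite \<Rightarrow> 'a::euclidean_space) \<Rightarrow> ('a \<Rightarrow> 'a) \<Rightarrow> real^'n^'n" where
  "frame_matrix e L = (\<chi> i j. e i \<bullet> L (e j))"

lemma frame_matrix_quadratic_form:
  fixes L :: "'a::euclidean_space \<Rightarrow> 'a" and e :: "'n::finite \<Rightarrow> 'a"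
  assumes "linear L"
  shows "w \<bullet> (frame_matrix e L *v w) = (\<Sum>i\<in>UNIV. (w $ i) *\<^sub>R e i) \<bullet> L (\<Sum>i\<in>UNIV. (w $ i) *\<^sub>R e i)"
  unfolding quadratic_form_sum
  by (subst sum.swap) (simp add: frame_matrix_def linear_sum[OF assms] linear_scale[OF assms] inner_sum_left
      inner_sum_right sum_distrib_left algebra_simps)

text \<open>The frame behind \<^const>\<open>tangent_matrix\<close> is an arbitrary choice. This lemma passes to a frame adapted
  to the geodesic at hand.\<close>

lemma tangent_matrix_change_frame:
  fixes L :: "'a::euclidean_space \<Rightarrow> 'a" and e :: "'n::finite \<Rightarrow> 'a"
  assumes e: "orthonormal_frame x e" and L: "linear L"
  obtains Q :: "real^'n^'n" where "orthogonal_matrix Q"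
    "frame_matrix e L = transpose Q ** tangent_matrix x L ** Q"
proof -
  define e0 :: "'n \<Rightarrow> 'a" where "e0 = (SOME e. orthonormal_frame x e)"
  have e0: "orthonormal_frame x e0" unfolding e0_def using e by (rule someI[where P="orthonormal_frame x"])
  define Q :: "real^'n^'n" where "Q = (\<chi> i j. e0 i \<bullet> e j)"
  have exp: "e j = (\<Sum>i\<in>UNIV. Q $ i $ j *\<^sub>R e0 i)" for j
    using orthonormal_frame_expansion[OF e0 orthonormal_frame_tangent[OF e, of j]] by (simp add: Q_def)
  have "(transpose Q ** Q) $ i $ j = e i \<bullet> e j" for i j
  proof -
    have "e i \<bullet> e j = (\<Sum>k\<in>UNIV. Q $ k $ i *\<^sub>R e0 k) \<bullet> e j" by (subst exp[of i]) simp
    also have "\<dots> = (transpose Q ** Q) $ i $ j"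
      by (simp add: inner_sum_left matrix_matrix_mult_def transpose_def) (simp add: Q_def)
    finally show ?thesis ..
  qed
  then have "orthogonal_matrix Q"
    using e by (simp add: orthogonal_matrix orthonormal_frame_def vec_eq_iff mat_def)
  moreover have "tangent_matrix x L = frame_matrix e0 L"
    by (simp add: tangent_matrix_def frame_matrix_def e0_def Let_def)
  moreover have "frame_matrix e L = transpose Q ** frame_matrix e0 L ** Q"
  proof -
    have "frame_matrix e L $ i $ j = (transpose Q ** frame_matrix e0 L ** Q) $ i $ j" for i j
  proof -
    have "frame_matrix e L $ i $ j = e i \<bullet> L (e j)" by (simp add: frame_matrix_def)
    also have "\<dots> = (\<Sum>k\<in>UNIV. Q $ k $ i *\<^sub>R e0 k) \<bullet> L (\<Sum>l\<in>UNIV. Q $ l $ j *\<^sub>R e0 l)"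
      by (simp add: exp[symmetric])
    also have "\<dots> = column i Q \<bullet> (frame_matrix e0 L *v column j Q)"
      by (simp add: frame_matrix_def linear_sum[OF L] linear_scale[OF L] inner_sum_left inner_sum_right
          inner_vec_def matrix_vector_mult_def column_def sum_distrib_left mult.commute mult.left_commute)
        (subst sum.swap, simp add: mult.left_commute)
    finally show ?thesis by (simp add: conjugate_entry)
    qed
    then show ?thesis by (simp add: vec_eq_iff)
  qed
  ultimately show ?thesis using that by simp
qed

text \<open>An orthonormal basis of the orthogonal complement of \<open>m\<close> and \<open>e\<close>, indexed by all of \<open>'n\<close> except \<open>k\<close>. The
  index \<open>k\<close> is reserved for the direction of the geodesic.\<close>

lemma adapted_orthonormal_system:
  fixes m e :: "'a::euclidean_space" and k :: "'n::finite"
  assumes dim: "DIM('a) = CARD('n) + 1" and me: "norm m = 1" "norm e = 1" "m \<bullet> e = 0"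
  obtains h :: "'n \<Rightarrow> 'a" where
    "\<And>i j. i \<noteq> k \<Longrightarrow> j \<noteq> k \<Longrightarrow> h i \<bullet> h j = (if i = j then 1 else 0)"
    "span (h ` (- {k})) = {v. v \<bullet> m = 0 \<and> v \<bullet> e = 0}"
proof -
  define S where "S = {v. v \<bullet> m = 0 \<and> v \<bullet> e = 0}"
  have S: "subspace S" by (auto simp: S_def subspace_def inner_add_left)
  have ne: "m \<noteq> e" using me by (auto simp: norm_eq_1)
  have "pairwise orthogonal {m, e}"
    using me by (auto simp: pairwise_insert orthogonal_def inner_commute)
  moreover have "0 \<notin> {m, e}" using me by auto
  ultimately have "independent {m, e}" by (rule pairwise_orthogonal_independent)
  then have "dim (span {m, e}) = 2"
    using ne by (simp add: dim_eq_card_independent)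
  moreover have "{v \<in> UNIV. \<forall>a\<in>span {m, e}. orthogonal a v} = S"
  proof -
    have "(\<forall>a\<in>span {m, e}. orthogonal a v) \<longleftrightarrow> v \<in> S" for v
    proof
      assume "\<forall>a\<in>span {m, e}. orthogonal a v"
      then have "orthogonal m v" "orthogonal e v" by (simp_all add: span_base)
      then show "v \<in> S" by (simp add: S_def orthogonal_def inner_commute)
    next
      assume "v \<in> S"
      then have "orthogonal v b" if "b \<in> {m, e}" for b
        using that by (auto simp: S_def orthogonal_def)
      then show "\<forall>a\<in>span {m, e}. orthogonal a v"
        by (metis orthogonal_to_span orthogonal_commute)
    qed
    then show ?thesis by blast
  qed
  ultimately have "dim S + 2 = DIM('a)"
    using dim_subspace_orthogonal_to_vectors[of "span {m, e}" UNIV] by simp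
  then have dS: "dim S = CARD('n) - 1" using dim by simp
  obtain B where B: "B \<subseteq> S" "pairwise orthogonal B" "\<And>x. x \<in> B \<Longrightarrow> norm x = 1" "independent B"
    "card B = dim S" "span B = S"
    using orthonormal_basis_subspace[OF S] by metis
  have "card (- {k}) = card B" by (simp add: B(5) dS Compl_eq_Diff_UNIV card_Diff_singleton)
  moreover have "finite B" using B(4) independent_imp_finite by blast
  ultimately obtain h where h: "bij_betw h (- {k}) B"
    using finite_same_card_bij[of "- {k}" B] by auto
  have "h i \<bullet> h j = (if i = j then 1 else 0)" if "i \<noteq> k" "j \<noteq> k" for i j
  proof (cases "i = j")
    case True
    then show ?thesis using B(3) bij_betwE[OF h] that by (simp add: norm_eq_1[symmetric])
  next
    case False
    then have "h i \<noteq> h j" using h that by (auto simp: bij_betw_def inj_on_def)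
    then show ?thesis using B(2) bij_betwE[OF h] that False by (auto simp: pairwise_def orthogonal_def)
  qed
  moreover have "span (h ` (- {k})) = S" using h B(6) by (simp add: bij_betw_def)
  ultimately show ?thesis using that[of h] unfolding S_def by blast
qed

lemma orthonormal_frame_adapted:
  fixes h :: "'n::finite \<Rightarrow> 'a::euclidean_space"
  assumes h: "\<And>i j. i \<noteq> k \<Longrightarrow> j \<noteq> k \<Longrightarrow> h i \<bullet> h j = (if i = j then 1 else 0)"
    and sp: "span (h ` (- {k})) = {v. v \<bullet> p = 0 \<and> v \<bullet> e = 0}"
    and pe: "norm e = 1" "p \<bullet> e = 0"
  shows "orthonormal_frame p (h(k := e))"
proof -
  have h0: "h i \<bullet> p = 0" "h i \<bullet> e = 0" if "i \<noteq> k" for i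
    using span_base[of "h i" "h ` (- {k})"] that sp by auto
  have "(h(k := e)) i \<bullet> (h(k := e)) j = (if i = j then 1 else 0)" for i j
    using h h0 pe by (auto simp: inner_commute norm_eq_1)
  moreover have "span (range (h(k := e))) = tangent_space p"
  proof
    show "span (range (h(k := e))) \<subseteq> tangent_space p"
    proof (rule span_minimal)
      show "subspace (tangent_space p)"
        by (auto simp: tangent_space_def subspace_def inner_add_left)
      show "range (h(k := e)) \<subseteq> tangent_space p"
        using h0 pe by (auto simp: tangent_space_def inner_commute)
    qed
    show "tangent_space p \<subseteq> span (range (h(k := e)))"
    proof
      fix v assume "v \<in> tangent_space p"
      then have "v - (v \<bullet> e) *\<^sub>R e \<in> span (h ` (- {k}))"
        using pe by (simp add: sp tangent_space_def inner_diff_left inner_diff_right inner_commute norm_eq_1)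
      moreover have "h ` (- {k}) \<subseteq> range (h(k := e))"
        by (auto simp: image_iff)
      ultimately have "v - (v \<bullet> e) *\<^sub>R e \<in> span (range (h(k := e)))" using span_mono by blast
      moreover have "e \<in> range (h(k := e))" by (metis fun_upd_same rangeI)
      then have "(v \<bullet> e) *\<^sub>R e \<in> span (range (h(k := e)))" by (simp add: span_base span_scale)
      ultimately show "v \<in> span (range (h(k := e)))" using span_add by fastforce
    qed
  qed
  ultimately show ?thesis by (simp add: orthonormal_frame_def)
qed

definition frame_vector :: "('n::finite \<Rightarrow> 'a::euclidean_space) \<Rightarrow> real^'n \<Rightarrow> 'a" where
  "frame_vector e w = (\<Sum>i\<in>UNIV. (w $ i) *\<^sub>R e i)"

lemma frame_vector_axis: "frame_vector e (axis i 1) = e i"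
  by (simp add: frame_vector_def axis_def if_distrib[where f="\<lambda>r. r *\<^sub>R _"] cong: if_cong)

lemma frame_vector_upd:
  "frame_vector (h(k := z)) w = (\<Sum>i\<in>- {k}. (w $ i) *\<^sub>R h i) + (w $ k) *\<^sub>R z"
proof -
  have "frame_vector (h(k := z)) w
      = (w $ k) *\<^sub>R z + (\<Sum>i\<in>UNIV - {k}. (w $ i) *\<^sub>R (h(k := z)) i)"
    unfolding frame_vector_def by (subst sum.remove[of _ k]) auto
  also have "(\<Sum>i\<in>UNIV - {k}. (w $ i) *\<^sub>R (h(k := z)) i) = (\<Sum>i\<in>- {k}. (w $ i) *\<^sub>R h i)"
    by (intro sum.cong) auto
  finally show ?thesis by (simp only: add.commute)
qed

section \<open>The concavity gap at an interior minimum\<close>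

text \<open>The vector \<open>sgn (x + y)\<close> is the midpoint of the minimizing geodesic from \<open>x\<close> to \<open>y\<close>.\<close>

definition concavity_gap :: "('a::euclidean_space \<Rightarrow> real) \<Rightarrow> 'a \<Rightarrow> 'a \<Rightarrow> real" where
  "concavity_gap u x y = u (sgn (x + y)) - (u x + u y) / 2"

text \<open>The points \<open>x\<close> and \<open>y\<close> move with velocities \<open>A\<close> and \<open>B\<close> of equal length. Then both are normalized by the
  same factor, so that their midpoint is the projection of \<open>x + y + t *\<^sub>R (A + B)\<close>, and the
  hypothesis on \<open>C\<close> says that this point moves along a great circle with velocity \<open>C\<close>.\<close>

lemma two_point_variation:
  fixes x y A B C :: "'a::euclidean_space" and u :: "'a \<Rightarrow> real"
  assumes op: "openin (top_of_set (sphere 0 1)) \<Omega>" and C2: "C2_on \<Omega> u"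
    and x: "x \<in> \<Omega>" and y: "y \<in> \<Omega>" and m: "sgn (x + y) \<in> \<Omega>"
    and min: "\<And>x' y'. x' \<in> \<Omega> \<Longrightarrow> y' \<in> \<Omega> \<Longrightarrow> concavity_gap u x y \<le> concavity_gap u x' y'"
    and A: "A \<bullet> x = 0" and B: "B \<bullet> y = 0" and AB: "A \<bullet> A = B \<bullet> B"
    and C: "C \<bullet> sgn (x + y) = 0"
    and mid: "\<forall>\<^sub>F t in nhds 0. sgn (x + y + t *\<^sub>R (A + B)) = sgn (sgn (x + y) + t *\<^sub>R C)"
  shows "grad u (sgn (x + y)) \<bullet> C = (grad u x \<bullet> A + grad u y \<bullet> B) / 2"
    and "(hess u x A \<bullet> A + hess u y B \<bullet> B) / 2 \<le> hess u (sgn (x + y)) C \<bullet> C"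
proof -
  let ?m = "sgn (x + y)"
  have unit: "norm x = 1" "norm y = 1" "norm ?m = 1" using x y m openin_imp_subset[OF op] by auto
  let ?\<phi> = "\<lambda>t. u (sgn (?m + t *\<^sub>R C)) - (u (sgn (x + t *\<^sub>R A)) + u (sgn (y + t *\<^sub>R B))) / 2"
  have jet: "jet2 ?\<phi> (grad u ?m \<bullet> C - (grad u x \<bullet> A + grad u y \<bullet> B) / 2)
    (hess u ?m C \<bullet> C - (hess u x A \<bullet> A + hess u y B \<bullet> B) / 2)"
    by (intro jet2_diff_average jet2_along_sgn_line[OF op C2] x y m A B C)
  have gap: "concavity_gap u (sgn (x + t *\<^sub>R A)) (sgn (y + t *\<^sub>R B)) = ?\<phi> t"
    if "sgn (x + y + t *\<^sub>R (A + B)) = sgn (?m + t *\<^sub>R C)" for t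
  proof -
    let ?r = "inverse (sqrt (1 + t\<^sup>2 * (A \<bullet> A)))"
    have "?r > 0" by (simp add: add_pos_nonneg)
    moreover have "sgn (x + t *\<^sub>R A) + sgn (y + t *\<^sub>R B) = ?r *\<^sub>R (x + y + t *\<^sub>R (A + B))"
      unfolding sgn_tangent_line[OF unit(1) A] sgn_tangent_line[OF unit(2) B] AB
      by (simp add: algebra_simps)
    ultimately have "sgn (sgn (x + t *\<^sub>R A) + sgn (y + t *\<^sub>R B)) = sgn (?m + t *\<^sub>R C)"
      using that by (simp add: sgn_scaleR)
    then show ?thesis by (simp add: concavity_gap_def)
  qed
  have sgnxy: "sgn x = x" "sgn y = y" "sgn ?m = ?m" using unit by (simp_all add: sgn_div_norm)
  have "?\<phi> 0 = concavity_gap u x y" by (simp add: concavity_gap_def sgnxy)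
  then have "?\<phi> 0 \<le> ?\<phi> t" if "sgn (x + y + t *\<^sub>R (A + B)) = sgn (?m + t *\<^sub>R C)"
    "sgn (x + t *\<^sub>R A) \<in> \<Omega>" "sgn (y + t *\<^sub>R B) \<in> \<Omega>" for t
    using min[OF that(2,3)] unfolding gap[OF that(1)] by simp
  then have "\<forall>\<^sub>F t in nhds 0. ?\<phi> 0 \<le> ?\<phi> t"
    by (rule eventually_mono[OF eventually_conj[OF mid
        eventually_conj[OF eventually_sgn_line_in[OF op x, of A] eventually_sgn_line_in[OF op y, of B]]]])
      auto
  from jet2_local_min[OF jet this]
  show "grad u ?m \<bullet> C = (grad u x \<bullet> A + grad u y \<bullet> B) / 2"
    "(hess u x A \<bullet> A + hess u y B \<bullet> B) / 2 \<le> hess u ?m C \<bullet> C" by simp_all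
qed

text \<open>The frames \<open>E1\<close> and \<open>E2\<close> are obtained from \<open>E0\<close> by parallel transport along the geodesic: they share the
  vectors orthogonal to the plane of the geodesic, while the vector with index \<open>k\<close> is the direction of
  the geodesic at the respective point. The constant \<open>c\<close> is the cosine of half the angle between \<open>x\<close>
  and \<open>y\<close>.\<close>

lemma two_point_comparison:
  fixes u :: "'a::euclidean_space \<Rightarrow> real" and x y :: 'a
  assumes dim: "DIM('a) = CARD('n::finite) + 1"
    and op: "openin (top_of_set (sphere 0 1)) \<Omega>" and C2: "C2_on \<Omega> u"
    and x: "x \<in> \<Omega>" and y: "y \<in> \<Omega>" and m: "sgn (x + y) \<in> \<Omega>" and xy: "x \<noteq> y" "y \<noteq> - x"
    and min: "\<And>x' y'. x' \<in> \<Omega> \<Longrightarrow> y' \<in> \<Omega> \<Longrightarrow> concavity_gap u x y \<le> concavity_gap u x' y'"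
  obtains c and k :: "'n::finite" and E0 E1 E2 :: "'n::finite \<Rightarrow> 'a" where "0 \<le> c" "c \<le> 1"
    "orthonormal_frame (sgn (x + y)) E0" "orthonormal_frame x E1" "orthonormal_frame y E2"
    "norm (grad u x) = norm (grad u y)" "norm (grad u (sgn (x + y))) \<le> norm (grad u x)"
    "\<And>w. hess u x (frame_vector E1 w) \<bullet> frame_vector E1 w
        + hess u y (frame_vector E2 w) \<bullet> frame_vector E2 w \<le> 0"
    "\<And>w w'. (\<And>i. w' $ i = (if i = k then w $ i else c * w $ i)) \<Longrightarrow>
      (hess u x (frame_vector E1 w') \<bullet> frame_vector E1 w'
        + hess u y (frame_vector E2 w') \<bullet> frame_vector E2 w') / 2
      \<le> hess u (sgn (x + y)) (frame_vector E0 w) \<bullet> frame_vector E0 w"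
proof -
  have unit: "norm x = 1" "norm y = 1" using x y openin_imp_subset[OF op] by auto
  have nz: "x + y \<noteq> 0" "y - x \<noteq> 0" using xy by (auto simp: add_eq_0_iff)
  define c where "c = norm (x + y) / 2"
  define s where "s = norm (y - x) / 2"
  define m' where "m' = sgn (x + y)"
  define e where "e = sgn (y - x)"
  define ex where "ex = s *\<^sub>R m' + c *\<^sub>R e"
  define ey where "ey = c *\<^sub>R e - s *\<^sub>R m'"
  have cs: "c > 0" "s > 0" using nz by (simp_all add: c_def s_def)
  have sum: "x + y = (2 * c) *\<^sub>R m'" and diff: "y - x = (2 * s) *\<^sub>R e"
    using nz by (simp_all add: c_def s_def m'_def e_def sgn_div_norm)
  have "2 *\<^sub>R x = (x + y) - (y - x)" "2 *\<^sub>R y = (x + y) + (y - x)" by (simp_all add: scaleR_2)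
  then have "2 *\<^sub>R x = 2 *\<^sub>R (c *\<^sub>R m' - s *\<^sub>R e)" "2 *\<^sub>R y = 2 *\<^sub>R (c *\<^sub>R m' + s *\<^sub>R e)"
    unfolding sum diff by (simp_all add: algebra_simps)
  then have xe: "x = c *\<^sub>R m' - s *\<^sub>R e" and ye: "y = c *\<^sub>R m' + s *\<^sub>R e" by simp_all
  have me: "norm m' = 1" "norm e = 1" using nz by (simp_all add: m'_def e_def norm_sgn)
  have "(x + y) \<bullet> (y - x) = 0"
    using unit by (simp add: inner_add_left inner_diff_right inner_diff_left inner_add_right inner_commute norm_eq_1)
  then have perp: "m' \<bullet> e = 0" using cs unfolding sum diff by simp
  have uu: "m' \<bullet> m' = 1" "e \<bullet> e = 1" using me by (simp_all add: norm_eq_1)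
  have "x \<bullet> x = 1" using unit by (simp add: norm_eq_1)
  then have css: "c * c + s * s = 1"
    using perp uu by (simp add: xe inner_diff_left inner_diff_right inner_commute)
  have back1: "m' = c *\<^sub>R x + s *\<^sub>R ex" "e = c *\<^sub>R ex - s *\<^sub>R x"
    and back2: "m' = c *\<^sub>R y - s *\<^sub>R ey" "e = c *\<^sub>R ey + s *\<^sub>R y"
    using css by (simp_all add: xe ye ex_def ey_def algebra_simps flip: scaleR_add_left)
  have exey: "norm ex = 1" "norm ey = 1" "x \<bullet> ex = 0" "y \<bullet> ey = 0"
    unfolding norm_eq_1 using perp uu css
    by (simp_all add: ex_def ey_def xe ye inner_add_left inner_add_right inner_diff_left
        inner_diff_right inner_commute[of e m'] algebra_simps)
  \<comment> \<open>The index that carries the direction of the geodesic is arbitrary.\<close>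
  fix k :: 'n
  obtain h :: "'n \<Rightarrow> 'a" where
    h: "\<And>i j. i \<noteq> k \<Longrightarrow> j \<noteq> k \<Longrightarrow> h i \<bullet> h j = (if i = j then 1 else 0)"
    and sp: "span (h ` (- {k})) = {v. v \<bullet> m' = 0 \<and> v \<bullet> e = 0}"
    using adapted_orthonormal_system[OF dim me perp] by metis
  have spx: "span (h ` (- {k})) = {v. v \<bullet> x = 0 \<and> v \<bullet> ex = 0}"
  proof -
    have "v \<bullet> m' = 0 \<and> v \<bullet> e = 0 \<longleftrightarrow> v \<bullet> x = 0 \<and> v \<bullet> ex = 0" for v
    proof
      assume "v \<bullet> m' = 0 \<and> v \<bullet> e = 0"
      then show "v \<bullet> x = 0 \<and> v \<bullet> ex = 0"
        unfolding xe ex_def by (simp add: inner_add_right inner_diff_right)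
    next
      assume "v \<bullet> x = 0 \<and> v \<bullet> ex = 0"
      then have "v \<bullet> (c *\<^sub>R x + s *\<^sub>R ex) = 0" "v \<bullet> (c *\<^sub>R ex - s *\<^sub>R x) = 0"
        by (simp_all add: inner_add_right inner_diff_right)
      then show "v \<bullet> m' = 0 \<and> v \<bullet> e = 0" unfolding back1[symmetric] by blast
    qed
    then show ?thesis unfolding sp by auto
  qed
  have spy: "span (h ` (- {k})) = {v. v \<bullet> y = 0 \<and> v \<bullet> ey = 0}"
  proof -
    have "v \<bullet> m' = 0 \<and> v \<bullet> e = 0 \<longleftrightarrow> v \<bullet> y = 0 \<and> v \<bullet> ey = 0" for v
    proof
      assume "v \<bullet> m' = 0 \<and> v \<bullet> e = 0"
      then show "v \<bullet> y = 0 \<and> v \<bullet> ey = 0"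
        unfolding ye ey_def by (simp add: inner_add_right inner_diff_right)
    next
      assume "v \<bullet> y = 0 \<and> v \<bullet> ey = 0"
      then have "v \<bullet> (c *\<^sub>R y - s *\<^sub>R ey) = 0" "v \<bullet> (c *\<^sub>R ey + s *\<^sub>R y) = 0"
        by (simp_all add: inner_add_right inner_diff_right)
      then show "v \<bullet> m' = 0 \<and> v \<bullet> e = 0" unfolding back2[symmetric] by blast
    qed
    then show ?thesis unfolding sp by auto
  qed
  define E0 where "E0 = h(k := e)"
  define E1 where "E1 = h(k := ex)"
  define E2 where "E2 = h(k := ey)"
  have fr: "orthonormal_frame m' E0" "orthonormal_frame x E1" "orthonormal_frame y E2"
    unfolding E0_def E1_def E2_def
    using orthonormal_frame_adapted[OF h sp me(2) perp] orthonormal_frame_adapted[OF h spx exey(1,3)]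
      orthonormal_frame_adapted[OF h spy exey(2,4)] by auto
  define V where "V w = (\<Sum>i\<in>- {k}. (w $ i) *\<^sub>R h i)" for w :: "real^'n"
  have E0w: "frame_vector E0 w = V w + (w $ k) *\<^sub>R e"
    and E1w: "frame_vector E1 w = V w + (w $ k) *\<^sub>R ex"
    and E2w: "frame_vector E2 w = V w + (w $ k) *\<^sub>R ey" for w
    unfolding E0_def E1_def E2_def V_def by (simp_all add: frame_vector_upd)
  have "V w \<in> span (h ` (- {k}))" for w
    unfolding V_def by (intro span_sum span_scale span_base) auto
  then have V: "V w \<bullet> m' = 0" "V w \<bullet> e = 0" "V w \<bullet> x = 0" "V w \<bullet> ex = 0" "V w \<bullet> y = 0" "V w \<bullet> ey = 0" for w
    using sp spx spy by blast+
  have tang: "frame_vector E0 w \<bullet> m' = 0" "frame_vector E1 w \<bullet> x = 0" "frame_vector E2 w \<bullet> y = 0" for w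
    using V[of w] perp exey by (simp_all add: E0w E1w E2w inner_add_left inner_add_right inner_commute)
  have len: "frame_vector E1 w \<bullet> frame_vector E1 w = frame_vector E2 w \<bullet> frame_vector E2 w" for w
    using V[of w] exey unfolding norm_eq_1
    by (simp add: E1w E2w inner_add_left inner_add_right inner_commute)
  have m'm: "m' \<in> \<Omega>" using m by (simp add: m'_def)
  have diff2: "grad u differentiable (at z within sphere 0 1)" "u differentiable (at z within sphere 0 1)"
    if "z \<in> \<Omega>" for z using C2 that by (auto simp: C2_on_def)
  \<comment> \<open>The points move in opposite directions. The sum \<open>x + y\<close> only changes by a multiple of the
    midpoint, so the midpoint is fixed and contributes neither to the first nor to the second
    variation.\<close>
  have opposite: "grad u x \<bullet> frame_vector E1 w = grad u y \<bullet> frame_vector E2 w"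
    "hess u x (frame_vector E1 w) \<bullet> frame_vector E1 w
        + hess u y (frame_vector E2 w) \<bullet> frame_vector E2 w \<le> 0" for w
  proof -
    have AB: "frame_vector E1 w + - frame_vector E2 w = (2 * (s * w $ k)) *\<^sub>R m'"
      by (simp add: E1w E2w ex_def ey_def algebra_simps flip: scaleR_2)
    have "((\<lambda>t. 2 * c + t * (2 * (s * w $ k))) \<longlongrightarrow> 2 * c + 0 * (2 * (s * w $ k))) (nhds 0)"
      by (intro tendsto_intros filterlim_ident)
    then have "\<forall>\<^sub>F t in nhds 0. 0 < 2 * c + t * (2 * (s * w $ k))"
      using cs by (intro order_tendstoD(1)[where y="2 * c"]) auto
    then have ev: "\<forall>\<^sub>F t in nhds 0. sgn (x + y + t *\<^sub>R (frame_vector E1 w + - frame_vector E2 w))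
        = sgn (sgn (x + y) + t *\<^sub>R 0)"
    proof eventually_elim
      case (elim t)
      have "x + y + t *\<^sub>R (frame_vector E1 w + - frame_vector E2 w) = (2 * c + t * (2 * (s * w $ k))) *\<^sub>R m'"
        unfolding AB sum by (simp add: scaleR_add_left)
      then show ?case using elim by (simp add: sgn_scaleR m'_def[symmetric])
    qed
    have neg: "- frame_vector E2 w \<bullet> y = 0"
      "frame_vector E1 w \<bullet> frame_vector E1 w = - frame_vector E2 w \<bullet> - frame_vector E2 w"
      using tang len by simp_all
    note var = two_point_variation[OF op C2 x y m min tang(2) neg _ ev]
    show "grad u x \<bullet> frame_vector E1 w = grad u y \<bullet> frame_vector E2 w"
      using var(1) by simp
    show "hess u x (frame_vector E1 w) \<bullet> frame_vector E1 w
        + hess u y (frame_vector E2 w) \<bullet> frame_vector E2 w \<le> 0"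
      using var(2) linear_neg[OF hess_linear[OF diff2(1)[OF y]]] by simp
  qed
  \<comment> \<open>The points move in parallel. Across the geodesic the midpoint moves faster than they do, by the
    factor \<open>1 / c\<close>; this is why \<open>w'\<close> carries the factor \<open>c\<close>.\<close>
  have parallel: "grad u m' \<bullet> frame_vector E0 w
      = (grad u x \<bullet> frame_vector E1 w' + grad u y \<bullet> frame_vector E2 w') / 2"
    "(hess u x (frame_vector E1 w') \<bullet> frame_vector E1 w'
        + hess u y (frame_vector E2 w') \<bullet> frame_vector E2 w') / 2
      \<le> hess u m' (frame_vector E0 w) \<bullet> frame_vector E0 w"
    if w': "\<And>i. w' $ i = (if i = k then w $ i else c * w $ i)" for w w'
  proof -
    have "V w' = c *\<^sub>R V w"
      unfolding V_def scaleR_sum_right by (intro sum.cong) (auto simp: w')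
    then have AB: "frame_vector E1 w' + frame_vector E2 w' = (2 * c) *\<^sub>R frame_vector E0 w"
      by (simp add: E1w E2w E0w w' ex_def ey_def scaleR_add_right scaleR_diff_right scaleR_2
          scaleR_left_commute flip: scaleR_scaleR)
    have "sgn (x + y + t *\<^sub>R (frame_vector E1 w' + frame_vector E2 w'))
        = sgn (sgn (x + y) + t *\<^sub>R frame_vector E0 w)" for t
    proof -
      have "x + y + t *\<^sub>R (frame_vector E1 w' + frame_vector E2 w')
          = (2 * c) *\<^sub>R (m' + t *\<^sub>R frame_vector E0 w)"
        unfolding AB sum by (simp add: algebra_simps)
      then show ?thesis using cs by (simp add: sgn_scaleR m'_def[symmetric])
    qed
    then have ev: "\<forall>\<^sub>F t in nhds 0. sgn (x + y + t *\<^sub>R (frame_vector E1 w' + frame_vector E2 w'))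
        = sgn (sgn (x + y) + t *\<^sub>R frame_vector E0 w)" by simp
    from two_point_variation[OF op C2 x y m min tang(2,3) len tang(1)[unfolded m'_def] ev]
    show "grad u m' \<bullet> frame_vector E0 w
        = (grad u x \<bullet> frame_vector E1 w' + grad u y \<bullet> frame_vector E2 w') / 2"
      "(hess u x (frame_vector E1 w') \<bullet> frame_vector E1 w'
        + hess u y (frame_vector E2 w') \<bullet> frame_vector E2 w') / 2
      \<le> hess u m' (frame_vector E0 w) \<bullet> frame_vector E0 w"
      by (simp_all add: m'_def)
  qed
  have c1: "c \<le> 1"
  proof -
    have "c * c \<le> 1" using css zero_le_square[of s] by linarith
    then show ?thesis using power2_le_imp_le[of c 1] by (simp add: power2_eq_square)
  qed
  have gradm: "grad u m' \<bullet> E0 i = (if i = k then 1 else c) * (grad u x \<bullet> E1 i)" for i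
  proof -
    define w' :: "real^'n" where "w' = (if i = k then 1 else c) *\<^sub>R axis i 1"
    have w': "w' $ j = (if j = k then axis i 1 $ j else c * axis i 1 $ j)" for j
      by (auto simp: w'_def axis_def)
    have "frame_vector E1 w' = (if i = k then 1 else c) *\<^sub>R frame_vector E1 (axis i 1)"
      by (simp add: frame_vector_def w'_def scaleR_sum_right)
    then show ?thesis
      using parallel(1)[OF w'] opposite(1)[of w'] by (simp add: frame_vector_axis)
  qed
  have gt: "grad u z \<bullet> z = 0" if "z \<in> \<Omega>" for z
    using grad_works(1)[of z u] diff2[OF that] openin_imp_subset[OF op] that by auto
  have "(norm (grad u x))\<^sup>2 = (norm (grad u y))\<^sup>2"
    unfolding orthonormal_frame_norm[OF fr(2) gt[OF x]] orthonormal_frame_norm[OF fr(3) gt[OF y]]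
    using opposite(1)[of "axis _ 1"] by (simp add: frame_vector_axis)
  then have g1: "norm (grad u x) = norm (grad u y)" by simp
  have "(norm (grad u m'))\<^sup>2 \<le> (norm (grad u x))\<^sup>2"
    unfolding orthonormal_frame_norm[OF fr(2) gt[OF x]] orthonormal_frame_norm[OF fr(1) gt[OF m'm]]
  proof (rule sum_mono)
    fix i
    have "(if i = k then 1 else c)\<^sup>2 * (grad u x \<bullet> E1 i)\<^sup>2 \<le> 1 * (grad u x \<bullet> E1 i)\<^sup>2"
      using c1 cs by (intro mult_right_mono) (auto simp: power_le_one)
    then show "(grad u m' \<bullet> E0 i)\<^sup>2 \<le> (grad u x \<bullet> E1 i)\<^sup>2"
      unfolding gradm power_mult_distrib by simp
  qed
  then have g2: "norm (grad u m') \<le> norm (grad u x)" by simp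
  show ?thesis
    using that[of c E0 E1 E2 k] cs c1 fr g1 g2 opposite(2) parallel(2) unfolding m'_def by simp
qed

text \<open>Where the gap is minimal, the comparison of Hessians and gradients at \<open>x\<close>, \<open>y\<close> and the midpoint bounds
  \<open>b\<close> at the midpoint, evaluated at \<open>u (sgn (x + y))\<close>, by its value at \<open>(u x + u y) / 2\<close>. As \<open>b\<close> is strictly
  decreasing in this argument, the gap cannot be negative.\<close>

lemma interior_minimum_nonneg:
  fixes u :: "'a::euclidean_space \<Rightarrow> real" and x y :: 'a
    and \<Gamma> :: "(real^'n) set" and f :: "real \<Rightarrow> real^'n^'n \<Rightarrow> real"
  assumes dim: "DIM('a) = CARD('n) + 1"
    and op: "openin (top_of_set (sphere 0 1)) \<Omega>" and C2: "C2_on \<Omega> u"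
    and solves: "solves \<Gamma> f b \<Omega> u"
    and f_spectral: "\<And>p. 0 \<le> p \<Longrightarrow> convex_spectral_function \<Gamma> (f p)"
    and f_mono: "\<And>p q A. A \<in> sym_matrices (closure \<Gamma>) \<Longrightarrow> 0 \<le> p \<Longrightarrow> p \<le> q \<Longrightarrow> f p A \<le> f q A"
    and b_decreasing: "\<And>x z p q. x \<in> \<Omega> \<Longrightarrow> 0 \<le> p \<Longrightarrow> p \<le> q \<Longrightarrow> b x z q \<le> b x z p"
    and b_strict: "\<And>x z w p. x \<in> \<Omega> \<Longrightarrow> 0 \<le> p \<Longrightarrow> z < w \<Longrightarrow> b x w p < b x z p"
    and b_concave: "\<And>p. 0 \<le> p \<Longrightarrow>
      (b x (u x) p + b y (u y) p) / 2 \<le> b (sgn (x + y)) ((u x + u y) / 2) p"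
    and x: "x \<in> \<Omega>" and y: "y \<in> \<Omega>" and m: "sgn (x + y) \<in> \<Omega>" and xy: "x \<noteq> y" "y \<noteq> - x"
    and min: "\<And>x' y'. x' \<in> \<Omega> \<Longrightarrow> y' \<in> \<Omega> \<Longrightarrow> concavity_gap u x y \<le> concavity_gap u x' y'"
  shows "0 \<le> concavity_gap u x y"
proof (rule ccontr)
  assume "\<not> 0 \<le> concavity_gap u x y"
  then have neg: "u (sgn (x + y)) < (u x + u y) / 2" by (simp add: concavity_gap_def)
  let ?m = "sgn (x + y)"
  obtain c k and E0 E1 E2 :: "'n \<Rightarrow> 'a" where c: "0 \<le> c" "c \<le> 1"
    and fr: "orthonormal_frame ?m E0" "orthonormal_frame x E1" "orthonormal_frame y E2"
    and grads: "norm (grad u x) = norm (grad u y)" "norm (grad u ?m) \<le> norm (grad u x)"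
    and turn: "\<And>w. hess u x (frame_vector E1 w) \<bullet> frame_vector E1 w
        + hess u y (frame_vector E2 w) \<bullet> frame_vector E2 w \<le> 0"
    and shift: "\<And>w w'. (\<And>i. w' $ i = (if i = k then w $ i else c * w $ i)) \<Longrightarrow>
      (hess u x (frame_vector E1 w') \<bullet> frame_vector E1 w'
        + hess u y (frame_vector E2 w') \<bullet> frame_vector E2 w') / 2
      \<le> hess u ?m (frame_vector E0 w) \<bullet> frame_vector E0 w"
    using two_point_comparison[OF dim op C2 x y m xy min] by metis
  define W where "W z E = frame_matrix E (\<lambda>v. - hess u z v)" for z and E :: "'n \<Rightarrow> 'a"
  define p where "p = norm (grad u x)"
  have p: "0 \<le> p" by (simp add: p_def)
  interpret convex_spectral_function \<Gamma> "f p" using f_spectral[OF p] .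
  have lin: "linear (\<lambda>v. - hess u z v)" if "z \<in> \<Omega>" for z
    using hess_linear[of u z] C2 that by (simp add: C2_on_def linear_compose_neg)
  have W: "W z E \<in> \<D>" "f (norm (grad u z)) (W z E) = b z (u z) (norm (grad u z))"
    if z: "z \<in> \<Omega>" and E: "orthonormal_frame z E" for z and E :: "'n \<Rightarrow> 'a"
  proof -
    let ?T = "tangent_matrix z (\<lambda>v. - hess u z v) :: real^'n^'n"
    have T: "?T \<in> \<D>" "f (norm (grad u z)) ?T = b z (u z) (norm (grad u z))"
      using solves z by (auto simp: solves_def)
    obtain Q :: "real^'n^'n" where Q: "orthogonal_matrix Q" "W z E = transpose Q ** ?T ** Q"
      unfolding W_def using tangent_matrix_change_frame[OF E lin[OF z]] by metis
    show "W z E \<in> \<D>" unfolding Q(2) using T(1) Q(1) by (rule sym_matrices_conjugate)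
    have "isotropic_on \<D> (f (norm (grad u z)))"
      using f_spectral[of "norm (grad u z)"] by (simp add: convex_spectral_function_def)
    then show "f (norm (grad u z)) (W z E) = b z (u z) (norm (grad u z))"
      unfolding Q(2) using T Q(1) isotropic_on_conjugate by metis
  qed
  have WQ: "w \<bullet> (W z E *v w) = - (hess u z (frame_vector E w) \<bullet> frame_vector E w)"
    if "z \<in> \<Omega>" for z w and E :: "'n \<Rightarrow> 'a"
    unfolding W_def frame_matrix_quadratic_form[OF lin[OF that]] frame_vector_def[symmetric]
    by (simp add: inner_commute)
  define M where "M = (1/2) *\<^sub>R (W x E1 + W y E2)"
  have MQ: "w \<bullet> (M *v w) = (w \<bullet> (W x E1 *v w) + w \<bullet> (W y E2 *v w)) / 2" for w
    by (simp add: M_def matrix_vector_mult_add_rdistrib inner_add_right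
        flip: scaleR_matrix_vector_assoc)
  have "transpose (W x E1) = W x E1" "transpose (W y E2) = W y E2"
    using W(1)[OF x fr(2)] W(1)[OF y fr(3)] by (simp_all add: sym_matrices_def)
  then have "transpose M = M" by (simp add: M_def transpose_def vec_eq_iff)
  moreover have "0 \<le> w \<bullet> (M *v w)" for w
    using turn[of w] by (simp add: MQ WQ x y)
  ultimately have psdM: "psd M" by (simp add: psd_def)
  have le: "w \<bullet> (W ?m E0 *v w) \<le> w' \<bullet> (M *v w')"
    if "\<And>i. w' $ i = (if i = k then w $ i else c * w $ i)" for w w'
    using shift[OF that] by (simp add: MQ WQ x y m field_simps)
  have main: "f p (W ?m E0) \<le> f p M"
    by (rule contraction_le[OF W(1)[OF m fr(1)] psdM c]) (rule le)
  have "b ?m (u ?m) (norm (grad u ?m)) = f (norm (grad u ?m)) (W ?m E0)"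
    using W(2)[OF m fr(1)] by simp
  also have "\<dots> \<le> f p (W ?m E0)"
    using W(1)[OF m fr(1)] grads(2) by (intro f_mono) (auto simp: p_def)
  also have "\<dots> \<le> f p M" by (rule main)
  also have "\<dots> \<le> (f p (W x E1) + f p (W y E2)) / 2"
    unfolding M_def by (rule conv[OF W(1)[OF x fr(2)] W(1)[OF y fr(3)]])
  also have "\<dots> = (b x (u x) p + b y (u y) p) / 2"
    using W(2)[OF x fr(2)] W(2)[OF y fr(3)] grads(1) by (simp add: p_def)
  also have "\<dots> \<le> b ?m ((u x + u y) / 2) p" by (rule b_concave[OF p])
  also have "\<dots> \<le> b ?m ((u x + u y) / 2) (norm (grad u ?m))"
    using m grads(2) by (intro b_decreasing) (auto simp: p_def)
  also have "\<dots> < b ?m (u ?m) (norm (grad u ?m))"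
    using m neg by (intro b_strict) auto
  finally show False by simp
qed

section \<open>The concavity gap at a boundary point\<close>

text \<open>The projection to the sphere of the chord from \<open>x\<close> to \<open>y\<close>. Unlike the arc length parametrization of
  the geodesic, this one is visibly continuous in all three arguments.\<close>

definition segment_sgn :: "'a::euclidean_space \<Rightarrow> 'a \<Rightarrow> real \<Rightarrow> 'a" where
  "segment_sgn x y s = sgn ((1 - s) *\<^sub>R x + s *\<^sub>R y)"

text \<open>The derivative of \<open>segment_sgn x y\<close> at \<open>s\<close>: the tangential part of \<open>y - x\<close>, rescaled.\<close>

definition segment_sgn_velocity :: "'a::euclidean_space \<Rightarrow> 'a \<Rightarrow> real \<Rightarrow> 'a" where
  "segment_sgn_velocity x y s = inverse (norm ((1 - s) *\<^sub>R x + s *\<^sub>R y)) *\<^sub>R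
     (y - x - ((y - x) \<bullet> segment_sgn x y s) *\<^sub>R segment_sgn x y s)"

lemma segment_nonzero:
  fixes x y :: "'a::euclidean_space"
  assumes "norm x = 1" "norm y = 1" "y \<noteq> - x" "0 \<le> s" "s \<le> 1"
  shows "(1 - s) *\<^sub>R x + s *\<^sub>R y \<noteq> 0"
proof
  assume z: "(1 - s) *\<^sub>R x + s *\<^sub>R y = 0"
  then have "(1 - s) *\<^sub>R x = - (s *\<^sub>R y)" by (simp add: eq_neg_iff_add_eq_0)
  then have "norm ((1 - s) *\<^sub>R x) = norm (s *\<^sub>R y)" by simp
  then have s: "s = 1/2" using assms by simp
  have "(1/2) *\<^sub>R (x + y) = 0" using z unfolding s by (simp add: scaleR_add_right)
  then show False using assms(3) by (simp add: add_eq_0_iff)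
qed

lemma segment_sgn_has_vector_derivative:
  fixes x y :: "'a::euclidean_space"
  assumes "(1 - s) *\<^sub>R x + s *\<^sub>R y \<noteq> 0"
  shows "(segment_sgn x y has_vector_derivative segment_sgn_velocity x y s) (at s within T)"
proof -
  let ?z = "\<lambda>s. (1 - s) *\<^sub>R x + s *\<^sub>R y"
  have dz: "(?z has_derivative (\<lambda>h. h *\<^sub>R (y - x))) (at s within T)"
    by (auto intro!: derivative_eq_intros simp: algebra_simps)
  have "((\<lambda>s. norm (?z s)) has_derivative (\<lambda>h. (h *\<^sub>R (y - x)) \<bullet> sgn (?z s))) (at s within T)"
    using has_derivative_compose[OF dz has_derivative_norm[OF assms]] by simp
  then have "((\<lambda>s. norm (?z s)) has_real_derivative (y - x) \<bullet> sgn (?z s)) (at s within T)"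
    unfolding has_field_derivative_def by (rule has_derivative_eq_rhs) (simp add: fun_eq_iff)
  then have di: "((\<lambda>s. inverse (norm (?z s))) has_real_derivative
      - (inverse (norm (?z s)) * ((y - x) \<bullet> sgn (?z s)) * inverse (norm (?z s)))) (at s within T)"
    using assms by (intro DERIV_inverse') auto
  have dz': "(?z has_vector_derivative y - x) (at s within T)"
    using dz by (simp add: has_vector_derivative_def)
  have "((\<lambda>s. inverse (norm (?z s)) *\<^sub>R ?z s) has_vector_derivative
      inverse (norm (?z s)) *\<^sub>R (y - x)
      + (- (inverse (norm (?z s)) * ((y - x) \<bullet> sgn (?z s)) * inverse (norm (?z s)))) *\<^sub>R ?z s) (at s within T)"
    by (rule has_vector_derivative_scaleR[OF di dz'])
  moreover have "inverse (norm (?z s)) *\<^sub>R (y - x)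
      + (- (inverse (norm (?z s)) * ((y - x) \<bullet> sgn (?z s)) * inverse (norm (?z s)))) *\<^sub>R ?z s
    = segment_sgn_velocity x y s"
    by (simp add: segment_sgn_velocity_def segment_sgn_def sgn_div_norm scaleR_diff_right mult.assoc
        mult.left_commute del: scaleR_add_right)
  ultimately show ?thesis by (simp add: segment_sgn_def[abs_def] sgn_div_norm)
qed

text \<open>The points \<open>segment_sgn x y s\<close> and \<open>segment_sgn y x s\<close> have the same midpoint as \<open>x\<close> and \<open>y\<close>, and the
  hypothesis says that the sum of the values of \<open>u\<close> at these points has a positive derivative at
  \<open>s = 0\<close>. At boundary points \<open>u\<close> need not be differentiable itself. Therefore the growth of the sum is
  estimated for pairs of points of \<open>\<Omega>\<close> near \<open>(x, y)\<close>, uniformly in the pair by continuity of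
  the extended gradient \<open>G\<close>, and then passed to the limit.\<close>

lemma boundary_descent:
  fixes u :: "'a::euclidean_space \<Rightarrow> real" and x y :: 'a
  assumes sph: "closure \<Omega> \<subseteq> sphere 0 1"
    and no_antipodal: "\<And>x y. x \<in> closure \<Omega> \<Longrightarrow> y \<in> closure \<Omega> \<Longrightarrow> y \<noteq> - x"
    and seg: "\<And>x y s. x \<in> \<Omega> \<Longrightarrow> y \<in> \<Omega> \<Longrightarrow> 0 \<le> s \<Longrightarrow> s \<le> 1 \<Longrightarrow> segment_sgn x y s \<in> \<Omega>"
    and segc: "\<And>x y s. x \<in> closure \<Omega> \<Longrightarrow> y \<in> closure \<Omega> \<Longrightarrow> 0 \<le> s \<Longrightarrow> s \<le> 1 \<Longrightarrow>
      segment_sgn x y s \<in> closure \<Omega>"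
    and cont: "continuous_on (closure \<Omega>) u"
    and diff: "\<And>x. x \<in> \<Omega> \<Longrightarrow> u differentiable (at x within sphere 0 1)"
    and contG: "continuous_on (closure \<Omega>) G" and G: "\<And>x. x \<in> \<Omega> \<Longrightarrow> G x = grad u x"
    and x: "x \<in> closure \<Omega>" and y: "y \<in> closure \<Omega>"
    and pos: "0 < G x \<bullet> (y - (x \<bullet> y) *\<^sub>R x) + G y \<bullet> (x - (x \<bullet> y) *\<^sub>R y)"
  shows "\<exists>x'\<in>closure \<Omega>. \<exists>y'\<in>closure \<Omega>. concavity_gap u x' y' < concavity_gap u x y"
proof -
  let ?C = "closure \<Omega>"
  have sub: "\<Omega> \<subseteq> ?C" by (rule closure_subset)
  have unit: "norm z = 1" if "z \<in> ?C" for z using sph that by auto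
  have nz: "(1 - s) *\<^sub>R x + s *\<^sub>R y \<noteq> 0" if "x \<in> ?C" "y \<in> ?C" "0 \<le> s" "s \<le> 1" for x y s
    using segment_nonzero unit no_antipodal that by blast
  define H where "H p = (case p of (x, y, s) \<Rightarrow> G (segment_sgn x y s) \<bullet> segment_sgn_velocity x y s
    + G (segment_sgn y x s) \<bullet> segment_sgn_velocity y x s)" for p
  define K where "K = ?C \<times> ?C \<times> {0..1::real}"
  have cX: "continuous_on K (\<lambda>(x, y, s). segment_sgn x y s)"
    "continuous_on K (\<lambda>(x, y, s). segment_sgn y x s)"
    unfolding segment_sgn_def split_def using nz
    by (auto intro!: continuous_intros simp: K_def)
  have cV: "continuous_on K (\<lambda>(x, y, s). segment_sgn_velocity x y s)"
    "continuous_on K (\<lambda>(x, y, s). segment_sgn_velocity y x s)"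
    unfolding segment_sgn_velocity_def split_def using nz cX[unfolded split_def]
    by (auto intro!: continuous_intros simp: K_def)
  have "continuous_on K (\<lambda>p. G ((\<lambda>(x, y, s). segment_sgn x y s) p))"
    using segc by (intro continuous_on_compose2[OF contG cX(1)]) (auto simp: K_def)
  moreover have "continuous_on K (\<lambda>p. G ((\<lambda>(x, y, s). segment_sgn y x s) p))"
    using segc by (intro continuous_on_compose2[OF contG cX(2)]) (auto simp: K_def)
  ultimately have contH: "continuous_on K H"
    unfolding H_def split_def using cV[unfolded split_def] by (auto intro!: continuous_intros simp: split_def)
  have sgnxy: "sgn x = x" "sgn y = y" using unit x y by (simp_all add: sgn_div_norm)
  have "segment_sgn_velocity x y 0 = y - (x \<bullet> y) *\<^sub>R x" "segment_sgn_velocity y x 0 = x - (x \<bullet> y) *\<^sub>R y"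
    using unit[OF x] unit[OF y] unit[OF x, unfolded norm_eq_1] unit[OF y, unfolded norm_eq_1]
    by (simp_all add: segment_sgn_velocity_def segment_sgn_def sgnxy inner_diff_left
        inner_commute algebra_simps)
  then have H0: "0 < H (x, y, 0)" using pos by (simp add: H_def segment_sgn_def sgnxy)
  define \<delta> where "\<delta> = H (x, y, 0) / 2"
  have \<delta>: "\<delta> > 0" using H0 by (simp add: \<delta>_def)
  have "(x, y, 0) \<in> K" using x y by (simp add: K_def)
  then obtain r where r: "r > 0" and near: "\<And>p. p \<in> K \<Longrightarrow> dist p (x, y, 0) < r \<Longrightarrow> dist (H p) (H (x, y, 0)) < \<delta>"
    using contH \<delta> unfolding continuous_on_iff by metis
  have Hpos: "\<delta> \<le> H p" if "p \<in> K" "dist p (x, y, 0) < r" for p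
    using near[OF that] by (auto simp: \<delta>_def dist_real_def abs_if split: if_splits)
  \<comment> \<open>The other half of \<open>r\<close> is left for the distances of the two approximating points.\<close>
  define s0 where "s0 = min 1 (r / 2)"
  have s0: "0 < s0" "s0 \<le> 1" "s0 \<le> r / 2" using r by (auto simp: s0_def)
  define \<phi> where "\<phi> x y s = u (segment_sgn x y s) + u (segment_sgn y x s)" for x y s
  obtain xs where xs: "\<And>n. xs n \<in> \<Omega>" "xs \<longlonglongrightarrow> x" using x closure_sequential by metis
  obtain ys where ys: "\<And>n. ys n \<in> \<Omega>" "ys \<longlonglongrightarrow> y" using y closure_sequential by metis
  have grow: "s0 * \<delta> \<le> \<phi> a b s0 - \<phi> a b 0"
    if a: "a \<in> \<Omega>" "dist a x < r / 4" and b: "b \<in> \<Omega>" "dist b y < r / 4" for a b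
  proof -
    have der: "((\<lambda>s. u (segment_sgn a b s)) has_real_derivative
        G (segment_sgn a b s) \<bullet> segment_sgn_velocity a b s) (at s within {0..s0})"
      if s: "s \<in> {0..s0}" and a: "a \<in> \<Omega>" and b: "b \<in> \<Omega>" for a b s
    proof -
      have nzs: "(1 - s) *\<^sub>R a + s *\<^sub>R b \<noteq> 0" using s s0 by (intro nz subsetD[OF sub] a b) auto
      have "segment_sgn a b t \<in> \<Omega>" if "t \<in> {0..s0}" for t
        using that s0 by (intro seg a b) auto
      then have in\<Omega>: "\<And>t. t \<in> {0..s0} \<Longrightarrow> segment_sgn a b t \<in> sphere 0 1" "segment_sgn a b s \<in> \<Omega>"
        using s sub sph by blast+
      have n1: "segment_sgn a b s \<bullet> segment_sgn a b s = 1" using in\<Omega>(1)[OF s] by (simp add: norm_eq_1)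
      have "segment_sgn_velocity a b s \<bullet> segment_sgn a b s = 0"
        using n1 by (simp add: segment_sgn_velocity_def inner_diff_left)
      then show ?thesis
        using grad_chain_rule[OF diff[OF in\<Omega>(2)] in\<Omega>(1) s segment_sgn_has_vector_derivative[OF nzs]]
          G[OF in\<Omega>(2)] by simp
    qed
    have "((\<lambda>s. \<phi> a b s) has_derivative (\<lambda>h. h * H (a, b, s))) (at s within {0..s0})"
      if "0 \<le> s" "s \<le> s0" for s
    proof -
      have "((\<lambda>s. \<phi> a b s) has_real_derivative H (a, b, s)) (at s within {0..s0})"
        unfolding \<phi>_def H_def using that der[of s a b] der[of s b a] a b
        by (auto intro!: derivative_eq_intros)
      then show ?thesis
        unfolding has_field_derivative_def by (rule has_derivative_eq_rhs) (simp add: fun_eq_iff)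
    qed
    then obtain \<xi> where \<xi>: "\<xi> \<in> {0<..<s0}" "\<phi> a b s0 - \<phi> a b 0 = (s0 - 0) * H (a, b, \<xi>)"
      using mvt_simple[of 0 s0 "\<lambda>s. \<phi> a b s" "\<lambda>s h. h * H (a, b, s)"] s0 by auto
    have "dist (a, b, \<xi>) (x, y, 0) \<le> dist a x + (dist b y + dist \<xi> 0)"
      unfolding dist_Pair_Pair
      by (meson add_left_mono order_trans sqrt_sum_squares_le_sum zero_le_dist real_sqrt_ge_zero
          sum_power2_ge_zero)
    also have "\<dots> < r" using a b \<xi> s0 by (auto simp: dist_real_def)
    finally have "\<delta> \<le> H (a, b, \<xi>)"
      using a b \<xi> s0 sub by (intro Hpos) (auto simp: K_def)
    then show ?thesis using \<xi> s0 by (simp add: mult_left_mono)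
  qed
  have "\<forall>\<^sub>F n in sequentially. dist (xs n) x < r / 4" "\<forall>\<^sub>F n in sequentially. dist (ys n) y < r / 4"
    using tendstoD[OF xs(2), of "r / 4"] tendstoD[OF ys(2), of "r / 4"] r by simp_all
  then have "\<forall>\<^sub>F n in sequentially. s0 * \<delta> \<le> \<phi> (xs n) (ys n) s0 - \<phi> (xs n) (ys n) 0"
    by eventually_elim (intro grow xs ys)
  moreover have "(\<lambda>n. \<phi> (xs n) (ys n) s) \<longlonglongrightarrow> \<phi> x y s" if s: "0 \<le> s" "s \<le> 1" for s
  proof -
    have "(\<lambda>n. segment_sgn (xs n) (ys n) s) \<longlonglongrightarrow> segment_sgn x y s"
      "(\<lambda>n. segment_sgn (ys n) (xs n) s) \<longlonglongrightarrow> segment_sgn y x s"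
      unfolding segment_sgn_def using nz[OF x y s] nz[OF y x s]
      by (auto intro!: tendsto_intros xs ys)
    then show ?thesis
      unfolding \<phi>_def using xs ys sub x y s
      by (intro tendsto_add continuous_on_tendsto_compose[OF cont]) (auto intro!: segc always_eventually)
  qed
  ultimately have "s0 * \<delta> \<le> \<phi> x y s0 - \<phi> x y 0"
    using s0 by (intro tendsto_lowerbound[OF tendsto_diff]) auto
  then have incr: "\<phi> x y 0 < \<phi> x y s0" using s0 \<delta> by (smt (verit) mult_pos_pos)
  have "sgn (segment_sgn x y s0 + segment_sgn y x s0) = sgn (x + y)"
  proof -
    let ?z = "(1 - s0) *\<^sub>R x + s0 *\<^sub>R y" and ?z' = "(1 - s0) *\<^sub>R y + s0 *\<^sub>R x"
    have "?z \<bullet> ?z = ?z' \<bullet> ?z'"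
      using unit[OF x] unit[OF y] by (simp add: inner_add_left inner_add_right norm_eq_1 inner_commute)
    then have "norm ?z = norm ?z'" by (simp add: norm_eq_sqrt_inner)
    then have "segment_sgn x y s0 + segment_sgn y x s0 = inverse (norm ?z) *\<^sub>R (?z + ?z')"
      by (simp add: segment_sgn_def sgn_div_norm scaleR_add_right)
    also have "?z + ?z' = x + y" by (simp add: algebra_simps)
    finally show ?thesis using nz[OF x y] s0 by (simp add: sgn_scaleR)
  qed
  then have "concavity_gap u (segment_sgn x y s0) (segment_sgn y x s0) < concavity_gap u x y"
    using incr by (simp add: concavity_gap_def \<phi>_def segment_sgn_def sgnxy)
  moreover have "segment_sgn x y s0 \<in> ?C" "segment_sgn y x s0 \<in> ?C"
    using segc x y s0 by auto
  ultimately show ?thesis by blast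
qed

text \<open>At a limit point of \<open>\<Omega>\<close> the limit of the gradient is unique, and so it is the value of the continuous
  extension.\<close>

lemma differential_ext_eq:
  assumes "continuous_on (closure \<Omega>) G" "\<And>x. x \<in> \<Omega> \<Longrightarrow> G x = grad u x"
    and "x \<in> closure \<Omega>" "x islimpt \<Omega>"
  shows "differential_ext \<Omega> u x v = G x \<bullet> v"
proof -
  have "(G \<longlongrightarrow> G x) (at x within closure \<Omega>)" using assms by (simp add: continuous_on_def)
  then have "(G \<longlongrightarrow> G x) (at x within \<Omega>)"
    by (rule tendsto_within_subset) (rule closure_subset)
  then have "(grad u \<longlongrightarrow> G x) (at x within \<Omega>)"
    by (rule Lim_transform_eventually) (simp add: eventually_at_filter assms(2))
  then have "Lim (at x within \<Omega>) (grad u) = G x"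
    using assms(4) by (intro tendsto_Lim) (auto simp: trivial_limit_within)
  then show ?thesis by (simp add: differential_ext_def)
qed

section \<open>Concavity from midpoints\<close>

text \<open>Subtract from \<open>g\<close> its chord over two points. The difference \<open>h\<close> vanishes at both ends, and the point where
  it is minimal is the midpoint of an end and another point; so half of the minimum is a lower bound
  for the minimum.\<close>

lemma midpoint_concave_on:
  fixes g :: "real \<Rightarrow> real"
  assumes cont: "continuous_on {a..b} g"
    and mid: "\<And>s t. s \<in> {a..b} \<Longrightarrow> t \<in> {a..b} \<Longrightarrow> (g s + g t) / 2 \<le> g ((s + t) / 2)"
  shows "concave_on {a..b} g"
  unfolding concave_on_iff
proof (intro conjI ballI allI impI)
  fix x y v w :: real
  assume x: "x \<in> {a..b}" and y: "y \<in> {a..b}" and vw: "0 \<le> v" "0 \<le> w" "v + w = 1"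
  define l where "l t = (1 - t) * x + t * y" for t
  define h where "h t = g (l t) - ((1 - t) * g x + t * g y)" for t
  have l: "l t \<in> {a..b}" if "t \<in> {0..1}" for t
    using convexD[OF convex_real_interval(5)[of a b] x y, of "1 - t" t] that by (simp add: l_def)
  have "continuous_on {0..1} l" unfolding l_def by (intro continuous_intros)
  then have "continuous_on {0..1} (\<lambda>t. g (l t))"
    using l by (intro continuous_on_compose2[OF cont]) auto
  then have "continuous_on {0..1} h" unfolding h_def by (intro continuous_intros)
  then obtain \<tau> where \<tau>: "\<tau> \<in> {0..1}" and min: "\<And>t. t \<in> {0..1} \<Longrightarrow> h \<tau> \<le> h t"
    using continuous_attains_inf[of "{0..1}" h] by auto
  have hmid: "(h s + h t) / 2 \<le> h ((s + t) / 2)" if "s \<in> {0..1}" "t \<in> {0..1}" for s t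
  proof -
    have "l ((s + t) / 2) = (l s + l t) / 2" by (simp add: l_def field_simps)
    then have "g (l ((s + t) / 2)) = g ((l s + l t) / 2)" by (rule arg_cong)
    then show ?thesis
      using mid[OF l[OF that(1)] l[OF that(2)]] unfolding h_def by (simp add: field_simps)
  qed
  have h0: "h 0 = 0" "h 1 = 0" by (simp_all add: h_def l_def)
  have "0 \<le> h \<tau>"
  proof (cases "\<tau> \<le> 1/2")
    case True
    then have "2 * \<tau> \<in> {0..1}" using \<tau> by auto
    then show ?thesis using hmid[of 0 "2 * \<tau>"] min[of "2 * \<tau>"] h0 by simp
  next
    case False
    then have "2 * \<tau> - 1 \<in> {0..1}" using \<tau> by auto
    then show ?thesis using hmid[of 1 "2 * \<tau> - 1"] min[of "2 * \<tau> - 1"] h0 by simp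
  qed
  then have "0 \<le> h w" using min[of w] vw by simp
  moreover have "1 - w = v" using vw by simp
  ultimately show "v * g x + w * g y \<le> g (v *\<^sub>R x + w *\<^sub>R y)"
    by (simp add: h_def l_def)
qed simp

text \<open>A geodesic that stays in \<open>C\<close> is shorter than \<open>pi\<close>, since it would otherwise contain two antipodal points.
  Hence each of its subarcs is minimizing, and the point at the average of two parameters is the
  midpoint \<^term>\<open>sgn (x + y)\<close> of the corresponding points.\<close>

lemma concave_along_geodesics_if_midpoint:
  fixes u :: "'a::euclidean_space \<Rightarrow> real"
  assumes cont: "continuous_on C u" and no_antipodal: "\<And>x y. x \<in> C \<Longrightarrow> y \<in> C \<Longrightarrow> y \<noteq> - x"
    and gap: "\<And>x y. x \<in> C \<Longrightarrow> y \<in> C \<Longrightarrow> 0 \<le> concavity_gap u x y"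
  shows "concave_along_geodesics C u"
  unfolding concave_along_geodesics_def
proof (intro allI impI)
  fix \<gamma> assume \<gamma>: "geodesic_on {-1..1} \<gamma> \<and> \<gamma> ` {-1..1} \<subseteq> C"
  obtain k p q where pq: "norm p = 1" "p \<bullet> q = 0" "k = 0 \<and> q = 0 \<or> 0 < k \<and> norm q = 1"
    and form: "\<And>t. t \<in> {-1..1} \<Longrightarrow> \<gamma> t = great_circle p q k t"
    using geodesic_on_great_circle_form \<gamma> by metis
  have C: "great_circle p q k t \<in> C" if "t \<in> {-1..1}" for t
    using \<gamma> that unfolding form[OF that, symmetric] by blast
  have k: "0 \<le> k" using pq(3) by auto
  have unit: "norm (great_circle p q k t) = 1" for t
    using pq norm_great_circle[of p q k t] by (auto simp: great_circle_def)
  have "2 * k < pi"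
  proof (rule ccontr)
    assume "\<not> 2 * k < pi"
    then have k2: "2 * k \<ge> pi" by simp
    then have kpos: "k > 0" using pi_gt_zero by linarith
    \<comment> \<open>At this time the geodesic has run through the length \<open>pi\<close>.\<close>
    define t where "t = pi / k - 1"
    have t: "t \<in> {-1..1}" using k2 kpos by (auto simp: t_def field_simps)
    have "k * t = pi - k" using kpos by (simp add: t_def field_simps)
    then have "great_circle p q k t = - great_circle p q k (-1)"
      by (simp add: great_circle_def)
    then show False using no_antipodal[OF C[of "-1"] C[OF t]] by simp
  qed
  have "concave_on {-1..1} (\<lambda>t. u (great_circle p q k t))"
  proof (rule midpoint_concave_on)
    have "continuous_on {-1..1} (great_circle p q k)"
      unfolding great_circle_def by (intro continuous_intros)
    then show "continuous_on {-1..1} (\<lambda>t. u (great_circle p q k t))"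
      using C by (intro continuous_on_compose2[OF cont]) auto
    fix s t :: real assume s: "s \<in> {-1..1}" and t: "t \<in> {-1..1}"
    have "\<bar>k * ((s - t) / 2)\<bar> \<le> k * 1"
      unfolding abs_mult using k s t by (intro mult_mono) (auto simp: abs_le_iff)
    then have pos: "cos (k * ((s - t) / 2)) > 0"
      using \<open>2 * k < pi\<close> by (intro cos_gt_zero_pi) (auto simp: abs_le_iff)
    have "great_circle p q k s + great_circle p q k t
        = (2 * cos (k * ((s - t) / 2))) *\<^sub>R great_circle p q k ((s + t) / 2)"
    proof -
      have s: "k * s = k * ((s + t) / 2) + k * ((s - t) / 2)"
        and t: "k * t = k * ((s + t) / 2) - k * ((s - t) / 2)" by (simp_all add: field_simps)
      show ?thesis
        unfolding great_circle_def
        by (subst s, subst t, subst s, subst t)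
          (simp only: cos_add cos_diff sin_add sin_diff, simp add: algebra_simps scaleR_2 flip: scaleR_scaleR)
    qed
    then have "sgn (great_circle p q k s + great_circle p q k t) = great_circle p q k ((s + t) / 2)"
      using pos unit[of "(s + t) / 2"] by (simp add: sgn_scaleR sgn_div_norm)
    then show "(u (great_circle p q k s) + u (great_circle p q k t)) / 2
        \<le> u (great_circle p q k ((s + t) / 2))"
      using gap[OF C[OF s] C[OF t]] by (simp add: concavity_gap_def)
  qed
  then show "concave_on {-1..1} (\<lambda>t. u (\<gamma> t))"
    using form convexD[OF convex_real_interval(5)[of "-1" 1]] by (simp add: concave_on_iff)
qed

section \<open>Concavity of solutions\<close>

theorem theorem1p1:
  fixes \<Omega> :: "'a::euclidean_space set"
    and \<Gamma> :: "(real ^ 'n) set"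
    and u :: "'a \<Rightarrow> real"
    and f :: "real \<Rightarrow> real ^ 'n ^ 'n \<Rightarrow> real"
    and b :: "'a \<Rightarrow> real \<Rightarrow> real \<Rightarrow> real"
  assumes n_ge_2: "CARD('n) \<ge> 2"
    and dim: "DIM('a) = CARD('n) + 1"
    and \<Omega>_open: "openin (top_of_set (sphere 0 1)) \<Omega>"
    and \<Omega>_connected: "connected \<Omega>"
    and closure_convex: "geodesically_convex (closure \<Omega>)"
    and \<Omega>_convex: "\<forall>x\<in>\<Omega>. \<forall>y\<in>\<Omega>. geo x y ` {-1..1} \<subseteq> \<Omega>"
    and \<Gamma>_symmetric: "symmetric_set \<Gamma>"
    and \<Gamma>_open: "open \<Gamma>"
    and \<Gamma>_convex: "convex \<Gamma>"
    and \<Gamma>_cone: "positive_cone \<Gamma>"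
    and \<Gamma>_pos: "{\<kappa>. \<forall>i. \<kappa> $ i > 0} \<subseteq> \<Gamma>"
    and u_C2: "C2_on \<Omega> u"
    and u_C1: "C1_on_closure \<Omega> u"
    and u_solves: "solves \<Gamma> f b \<Omega> u"
    and f_isotropic: "\<forall>p\<ge>0. isotropic_on (sym_matrices (closure \<Gamma>)) (f p)"
    and f_mono1: "\<forall>p q. \<forall>A\<in>sym_matrices (closure \<Gamma>). 0 \<le> p \<and> p \<le> q \<longrightarrow> f p A \<le> f q A"
    and f_mono2: "\<forall>p\<ge>0. \<forall>\<kappa>\<in>closure \<Gamma>. \<forall>\<mu>\<in>closure \<Gamma>.
        (\<forall>i. \<kappa> $ i \<le> \<mu> $ i) \<longrightarrow> f p (diag_matrix \<kappa>) \<le> f p (diag_matrix \<mu>)"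
    and f_convex: "\<forall>p\<ge>0. \<forall>A\<in>sym_matrices (closure \<Gamma>). \<forall>B\<in>sym_matrices (closure \<Gamma>).
        f p ((1/2) *\<^sub>R (A + B)) \<le> 1/2 * (f p A + f p B)"
    and b_decreasing: "\<forall>x\<in>\<Omega>. \<forall>z p q. 0 \<le> p \<and> p \<le> q \<longrightarrow> b x z q \<le> b x z p"
    and b_concave: "\<forall>x\<in>\<Omega>. \<forall>y\<in>\<Omega>. \<forall>p\<ge>0.
        b (geo x y 0) (1/2 * (u x + u y)) p \<ge> 1/2 * b x (u x) p + 1/2 * b y (u y) p"
    and b_strict: "\<forall>x\<in>\<Omega>. \<forall>z w. \<forall>p\<ge>0. z < w \<longrightarrow> b x w p < b x z p"
    and boundary: "\<forall>x\<in>(top_of_set (sphere 0 1)) frontier_of \<Omega>. \<forall>y\<in>closure \<Omega>. x \<noteq> y \<longrightarrow>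
        differential_ext \<Omega> u x (velocity (geo x y) (-1))
          - differential_ext \<Omega> u y (velocity (geo x y) 1) > 0"
  shows "concave_along_geodesics (closure \<Omega>) u"
proof -
  let ?C = "closure \<Omega>"
  have sub: "\<Omega> \<subseteq> ?C" by (rule closure_subset)
  have sph: "?C \<subseteq> sphere 0 1" using closure_convex by (simp add: geodesically_convex_def)
  have no_antipodal: "y \<noteq> - x" and geo_C: "geo x y ` {-1..1} \<subseteq> ?C" if "x \<in> ?C" "y \<in> ?C" for x y
    using closure_convex that by (simp_all add: geodesically_convex_def)
  have unit: "norm x = 1" if "x \<in> ?C" for x using sph that by auto
  have seg_geo: "segment_sgn x y s \<in> geo x y ` {-1..1}"
    if "x \<in> ?C" "y \<in> ?C" "x \<noteq> y" "0 \<le> s" "s \<le> 1" for x y s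
    unfolding segment_sgn_def using that unit no_antipodal by (intro sgn_segment_in_geo) auto
  have seg_refl: "segment_sgn x x s = x" if "x \<in> ?C" for x s
    using unit[OF that] by (simp add: segment_sgn_def sgn_div_norm flip: scaleR_add_left)
  have seg: "segment_sgn x y s \<in> \<Omega>" if "x \<in> \<Omega>" "y \<in> \<Omega>" "0 \<le> s" "s \<le> 1" for x y s
  proof (cases "x = y")
    case True
    then show ?thesis using seg_refl that sub by auto
  next
    case False
    then show ?thesis using seg_geo[of x y s] that sub \<Omega>_convex by blast
  qed
  have segc: "segment_sgn x y s \<in> ?C" if "x \<in> ?C" "y \<in> ?C" "0 \<le> s" "s \<le> 1" for x y s
  proof (cases "x = y")
    case True
    then show ?thesis using seg_refl that by auto
  next
    case False
    then show ?thesis using seg_geo[of x y s] that geo_C by blast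
  qed
  have half: "segment_sgn x y (1/2) = sgn (x + y)" for x y :: 'a
  proof -
    have "(1 - 1/2) *\<^sub>R x + (1/2) *\<^sub>R y = (1/2) *\<^sub>R (x + y)" by (simp add: scaleR_add_right)
    then show ?thesis by (simp add: segment_sgn_def sgn_scaleR)
  qed
  have cont: "continuous_on ?C u" and diff: "\<And>x. x \<in> \<Omega> \<Longrightarrow> u differentiable (at x within sphere 0 1)"
    using u_C1 by (auto simp: C1_on_closure_def)
  obtain G where contG: "continuous_on ?C G" and G: "\<And>x. x \<in> \<Omega> \<Longrightarrow> G x = grad u x"
    using u_C1 by (auto simp: C1_on_closure_def)
  have gap_nonneg: "0 \<le> concavity_gap u x y" if xy: "x \<in> ?C" "y \<in> ?C" for x y
  proof -
    have "compact ?C"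
      using sph bounded_subset[OF bounded_sphere] by (simp add: compact_eq_bounded_closed)
    then have "compact (?C \<times> ?C)" by (intro compact_Times)
    moreover have "continuous_on (?C \<times> ?C) (\<lambda>p. concavity_gap u (fst p) (snd p))"
    proof -
      have "continuous_on (?C \<times> ?C) (\<lambda>p. sgn (fst p + snd p))"
        using no_antipodal by (intro continuous_intros) (auto simp: add_eq_0_iff)
      then have "continuous_on (?C \<times> ?C) (\<lambda>p. u (sgn (fst p + snd p)))"
        using segc[of _ _ "1/2"] by (intro continuous_on_compose2[OF cont]) (auto simp: half)
      moreover have "continuous_on (?C \<times> ?C) (\<lambda>p. u (fst p))" "continuous_on (?C \<times> ?C) (\<lambda>p. u (snd p))"
        by (auto intro!: continuous_on_compose2[OF cont] continuous_intros)
      ultimately show ?thesis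
        unfolding concavity_gap_def by (intro continuous_intros) auto
    qed
    ultimately obtain p where p: "p \<in> ?C \<times> ?C"
      and minp: "\<And>q. q \<in> ?C \<times> ?C \<Longrightarrow> concavity_gap u (fst p) (snd p) \<le> concavity_gap u (fst q) (snd q)"
      using continuous_attains_inf[of "?C \<times> ?C"] xy by blast
    define x0 where "x0 = fst p"
    define y0 where "y0 = snd p"
    have x0: "x0 \<in> ?C" and y0: "y0 \<in> ?C" using p by (auto simp: x0_def y0_def)
    have min: "concavity_gap u x0 y0 \<le> concavity_gap u x' y'" if "x' \<in> ?C" "y' \<in> ?C" for x' y'
      using minp[of "(x', y')"] that by (simp add: x0_def y0_def)
    have "0 \<le> concavity_gap u x0 y0"
    proof (cases "x0 = y0")
      case True
      then show ?thesis
        using half[of x0 x0] seg_refl[OF x0] by (simp add: concavity_gap_def)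
    next
      case False
      have "\<Omega> \<noteq> {z}" for z using x0 y0 False by auto
      then have islimpt: "z islimpt \<Omega>" if "z \<in> ?C" for z
        using that connected_imp_perfect[OF \<Omega>_connected] by (cases "z \<in> \<Omega>") (auto simp: closure_def)
      \<comment> \<open>The gap is symmetric, so this applies to either point of the minimal pair.\<close>
      have interior: "z \<in> \<Omega>" if z: "z \<in> ?C" and w: "w \<in> ?C" and zw: "z \<noteq> w"
        and min: "\<And>x' y'. x' \<in> ?C \<Longrightarrow> y' \<in> ?C \<Longrightarrow> concavity_gap u z w \<le> concavity_gap u x' y'" for z w
      proof (rule ccontr)
        assume "z \<notin> \<Omega>"
        then have "z \<in> (top_of_set (sphere 0 1)) frontier_of \<Omega>"
          using z sph openin_imp_subset[OF \<Omega>_open]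
          by (auto simp: frontier_of_def interior_of_openin[OF \<Omega>_open] closure_of_subtopology Int_absorb1)
        then have "0 < differential_ext \<Omega> u z (velocity (geo z w) (-1))
            - differential_ext \<Omega> u w (velocity (geo z w) 1)"
          using boundary w zw by blast
        then have "0 < G z \<bullet> velocity (geo z w) (-1) - G w \<bullet> velocity (geo z w) 1"
          using differential_ext_eq[OF contG G] z w islimpt by simp
        moreover obtain r where "r > 0" "velocity (geo z w) (-1) = r *\<^sub>R (w - (z \<bullet> w) *\<^sub>R z)"
          "velocity (geo z w) 1 = - r *\<^sub>R (z - (z \<bullet> w) *\<^sub>R w)"
          using geo_velocity[OF unit[OF z] unit[OF w] zw no_antipodal[OF z w]] by metis
        ultimately have "0 < r * (G z \<bullet> (w - (z \<bullet> w) *\<^sub>R z) + G w \<bullet> (z - (z \<bullet> w) *\<^sub>R w))"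
          by (simp add: distrib_left)
        then have pos: "0 < G z \<bullet> (w - (z \<bullet> w) *\<^sub>R z) + G w \<bullet> (z - (z \<bullet> w) *\<^sub>R w)"
          using \<open>r > 0\<close> by (simp add: zero_less_mult_iff)
        have "\<exists>x'\<in>?C. \<exists>y'\<in>?C. concavity_gap u x' y' < concavity_gap u z w"
          by (rule boundary_descent[OF sph _ _ _ cont _ contG _ z w])
            (assumption | rule no_antipodal seg segc diff G pos)+
        then show False using min by (meson not_less)
      qed
      have x1: "x0 \<in> \<Omega>" using interior[OF x0 y0 False min] by blast
      have "concavity_gap u y0 x0 = concavity_gap u x0 y0" by (simp add: concavity_gap_def add.commute)
      then have y1: "y0 \<in> \<Omega>" using interior[OF y0 x0] False min by metis
      have mid: "sgn (x0 + y0) \<in> \<Omega>" using seg[OF x1 y1, of "1/2"] by (simp add: half)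
      have spectral: "convex_spectral_function \<Gamma> (f p)" if p: "0 \<le> p" for p
      proof
        show "symmetric_set \<Gamma>" by fact
        show "{\<kappa>. \<forall>i. \<kappa> $ i > 0} \<subseteq> \<Gamma>" by fact
        show "isotropic_on (sym_matrices (closure \<Gamma>)) (f p)" using f_isotropic p by blast
        show "f p (diag_matrix \<kappa>) \<le> f p (diag_matrix \<mu>)"
          if "\<kappa> \<in> closure \<Gamma>" "\<mu> \<in> closure \<Gamma>" "\<And>i. \<kappa> $ i \<le> \<mu> $ i" for \<kappa> \<mu>
          using f_mono2 p that by blast
        show "f p ((1/2) *\<^sub>R (A + B)) \<le> (f p A + f p B) / 2"
          if "A \<in> sym_matrices (closure \<Gamma>)" "B \<in> sym_matrices (closure \<Gamma>)" for A B
          using f_convex p that by force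
      qed
      have b_mid: "(b x0 (u x0) p + b y0 (u y0) p) / 2 \<le> b (sgn (x0 + y0)) ((u x0 + u y0) / 2) p"
        if "0 \<le> p" for p
        using b_concave[rule_format, OF x1 y1 that]
          geo_midpoint[OF unit[OF x0] unit[OF y0] False no_antipodal[OF x0 y0]]
        by (simp add: add_divide_distrib)
      show ?thesis
      proof (rule interior_minimum_nonneg[OF dim \<Omega>_open u_C2 u_solves spectral _ _ _ b_mid x1 y1 mid False
            no_antipodal[OF x0 y0]])
        show "f p A \<le> f q A" if "A \<in> sym_matrices (closure \<Gamma>)" "0 \<le> p" "p \<le> q" for p q A
          using f_mono1 that by blast
        show "b x z q \<le> b x z p" if "x \<in> \<Omega>" "0 \<le> p" "p \<le> q" for x z p q
          using b_decreasing that by blast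
        show "b x w p < b x z p" if "x \<in> \<Omega>" "0 \<le> p" "z < w" for x z w p
          using b_strict that by blast
        show "concavity_gap u x0 y0 \<le> concavity_gap u x' y'" if "x' \<in> \<Omega>" "y' \<in> \<Omega>" for x' y'
          using that sub by (intro min) auto
      qed
    qed
    then show ?thesis using min[OF xy] by simp
  qed
  show ?thesis
    using cont no_antipodal gap_nonneg by (rule concave_along_geodesics_if_midpoint)
qed

end
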